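(* Let $\mathcal{A}$ be a unital C$^*$-algebra and let $\mathcal{V}$ be an action of $\Gamma^+$ on $\mathcal{A}$. The following are equivalent: 1) there exists an action $\mathcal{H}$ such that $(\mathcal{V},\mathcal{H})$ is a complete interaction; 2) (i) there exists an action $\mathcal{H}$ such that $(\mathcal{V},\mathcal{H})$ is an interaction, (ii) $\mathcal{V}_x(\mathcal{A})$ and $\mathcal{H}_x(\mathcal{A})$ are hereditary C$^*$-subalgebras of $\mathcal{A}$ for each $x\in\Gamma^+$, and (iii) $\mathcal{V}_x(1)$ and $\mathcal{H}_y(1)$ commute for all $x,y\in\Gamma^+$; 3) (i) for each $x\in\Gamma^+$, $\mathcal{V}_x(1)$ is an orthogonal projection and $\mathcal{V}_x(\mathcal{A})=\mathcal{V}_x(1)\mathcal{A}\mathcal{V}_x(1)$, and (ii) there exists a decreasing family $\{P_x\}_{x\in\Gamma^+}$ of orthogonal projections in $\mathcal{A}$ such that (a) $\mathcal{V}_x(1)$ and $P_y$ commute for all $x,y\in\Gamma^+$, (b) $\mathcal{V}_x(P_{x+y})=\mathcal{V}_x(1)P_y$ for all $x,y\in\Gamma^+$, and (c) for each $x\in\Gamma^+$ the restriction $\mathcal{V}_x:P_x\mathcal{A}P_x\to\mathcal{V}_x(\mathcal{A})$ is a $*$-isomorphism. Moreover, the action $\mathcal{H}$ in 1) and 2) is unique, the family $\{P_x\}$ in 3) is unique, and they are related by $P_x=\mathcal{H}_x(1)$ and $\mathcal{H}_x(a)=\mathcal{V}_x^{-1}(\mathcal{V}_x(1)a\mathcal{V}_x(1))$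 for $a\in\mathcal{A}$, $x\in\Gamma^+$, where $\mathcal{V}_x^{-1}:\mathcal{V}_x(\mathcal{A})\to P_x\mathcal{A}P_x$ is the inverse of the $*$-isomorphism $\mathcal{V}_x:P_x\mathcal{A}P_x\to\mathcal{V}_x(\mathcal{A})$.
   Context: $\Gamma$ is a totally ordered abelian group with identity $0$ and $\Gamma^+=\{x\in\Gamma:0\le x\}$. An action of $\Gamma^+$ on $\mathcal{A}$ is a map $x\mapsto\mathcal{V}_x$ from $\Gamma^+$ into the bounded positive linear maps $\mathcal{A}\to\mathcal{A}$ with $\mathcal{V}_0=\mathrm{Id}$ and $\mathcal{V}_x\circ\mathcal{V}_y=\mathcal{V}_{x+y}$. An interaction is a pair $(\mathcal{V},\mathcal{H})$ of actions such that for every $x\in\Gamma^+$: (i) $\mathcal{V}_x\mathcal{H}_x\mathcal{V}_x=\mathcal{V}_x$; (ii) $\mathcal{H}_x\mathcal{V}_x\mathcal{H}_x=\mathcal{H}_x$; (iii) $\mathcal{V}_x(ab)=\mathcal{V}_x(a)\mathcal{V}_x(b)$ whenever $a$ or $b$ belongs to $\mathcal{H}_x(\mathcal{A})$; (iv) $\mathcal{H}_x(ab)=\mathcal{H}_x(a)\mathcal{H}_x(b)$ whenever $a$ or $b$ belongs to $\mathcal{V}_x(\mathcal{A})$. An interaction is complete if moreover $\mathcal{H}_x(\mathcal{V}_x(a))=\mathcal{H}_x(1)a\mathcal{H}_x(1)$ and $\mathcal{V}_x(\mathcal{H}_x(a))=\mathcal{V}_x(1)a\mathcal{V}_x(1)$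 for all $x\in\Gamma^+$, $a\in\mathcal{A}$, and $\mathcal{H}_y(1)\mathcal{V}_x(1)=\mathcal{V}_x(1)\mathcal{H}_y(1)$ for all $x,y\in\Gamma^+$. *)

theory Defs
  imports "HOL-Analysis.Analysis"
begin

class cstar_algebra = banach + real_normed_algebra_1 +
  fixes cscale :: "complex \<Rightarrow> 'a \<Rightarrow> 'a"
    and adj :: "'a \<Rightarrow> 'a"
  assumes cscale_add_left: "cscale (c + d) x = cscale c x + cscale d x"
    and cscale_add_right: "cscale c (x + y) = cscale c x + cscale c y"
    and cscale_cscale: "cscale c (cscale d x) = cscale (c * d) x"
    and cscale_of_real: "cscale (complex_of_real r) x = scaleR r x"
    and cscale_mult_left: "cscale c (x * y) = cscale c x * y"
    and cscale_mult_right: "cscale c (x * y) = x * cscale c y"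
    and norm_cscale: "norm (cscale c x) = cmod c * norm x"
    and adj_adj: "adj (adj x) = x"
    and adj_add: "adj (x + y) = adj x + adj y"
    and adj_mult: "adj (x * y) = adj y * adj x"
    and adj_cscale: "adj (cscale c x) = cscale (cnj c) (adj x)"
    and cstar_identity: "norm (adj x * x) = (norm x)\<^sup>2"

definition cpos :: "'a::cstar_algebra \<Rightarrow> bool" where
  "cpos a \<longleftrightarrow> (\<exists>b. a = adj b * b)"

definition cle :: "'a::cstar_algebra \<Rightarrow> 'a \<Rightarrow> bool" where
  "cle a b \<longleftrightarrow> cpos (b - a)"

definition is_proj :: "'a::cstar_algebra \<Rightarrow> bool" where
  "is_proj p \<longleftrightarrow> adj p = p \<and> p * p = p"

definition corner :: "'a::cstar_algebra \<Rightarrow> 'a set" where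
  "corner p = {p * a * p | a. True}"

definition clinear_map :: "('a::cstar_algebra \<Rightarrow> 'a) \<Rightarrow> bool" where
  "clinear_map f \<longleftrightarrow> (\<forall>a b. f (a + b) = f a + f b) \<and> (\<forall>c a. f (cscale c a) = cscale c (f a))"

definition bounded_map :: "('a::cstar_algebra \<Rightarrow> 'a) \<Rightarrow> bool" where
  "bounded_map f \<longleftrightarrow> (\<exists>K. \<forall>a. norm (f a) \<le> K * norm a)"

definition positive_map :: "('a::cstar_algebra \<Rightarrow> 'a) \<Rightarrow> bool" where
  "positive_map f \<longleftrightarrow> (\<forall>a. cpos a \<longrightarrow> cpos (f a))"

definition hereditary_subalg :: "'a::cstar_algebra set \<Rightarrow> bool" where
  "hereditary_subalg B \<longleftrightarrow>
     0 \<in> B \<and> (\<forall>a\<in>B. \<forall>b\<in>B. a + b \<in> B) \<and> (\<forall>c. \<forall>a\<in>B. cscale c a \<in> B)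
     \<and> (\<forall>a\<in>B. \<forall>b\<in>B. a * b \<in> B) \<and> (\<forall>a\<in>B. adj a \<in> B) \<and> closed B
     \<and> (\<forall>a b. b \<in> B \<longrightarrow> cpos a \<longrightarrow> cle a b \<longrightarrow> a \<in> B)"

definition star_iso_on :: "('a::cstar_algebra \<Rightarrow> 'a) \<Rightarrow> 'a set \<Rightarrow> 'a set \<Rightarrow> bool" where
  "star_iso_on f S T \<longleftrightarrow> bij_betw f S T
     \<and> (\<forall>a\<in>S. \<forall>b\<in>S. f (a + b) = f a + f b)
     \<and> (\<forall>c. \<forall>a\<in>S. f (cscale c a) = cscale c (f a))
     \<and> (\<forall>a\<in>S. \<forall>b\<in>S. f (a * b) = f a * f b)
     \<and> (\<forall>a\<in>S. f (adj a) = adj (f a))"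

text \<open>Gamma is a type of class linordered_ab_group_add; Gamma^+ = {x. 0 \<le> x}.
  Values of an action outside Gamma^+ are irrelevant.\<close>

definition is_action :: "('g::linordered_ab_group_add \<Rightarrow> 'a::cstar_algebra \<Rightarrow> 'a) \<Rightarrow> bool" where
  "is_action V \<longleftrightarrow>
     (\<forall>x\<ge>0. bounded_map (V x) \<and> positive_map (V x) \<and> clinear_map (V x))
     \<and> V 0 = id
     \<and> (\<forall>x\<ge>0. \<forall>y\<ge>0. V x \<circ> V y = V (x + y))"

definition interaction :: "('g::linordered_ab_group_add \<Rightarrow> 'a::cstar_algebra \<Rightarrow> 'a) \<Rightarrow> ('g \<Rightarrow> 'a \<Rightarrow> 'a) \<Rightarrow> bool" where
  "interaction V H \<longleftrightarrow> is_action V \<and> is_action H \<and>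
     (\<forall>x\<ge>0.
        V x \<circ> H x \<circ> V x = V x
      \<and> H x \<circ> V x \<circ> H x = H x
      \<and> (\<forall>a b. (a \<in> range (H x) \<or> b \<in> range (H x)) \<longrightarrow> V x (a * b) = V x a * V x b)
      \<and> (\<forall>a b. (a \<in> range (V x) \<or> b \<in> range (V x)) \<longrightarrow> H x (a * b) = H x a * H x b))"

definition complete_interaction :: "('g::linordered_ab_group_add \<Rightarrow> 'a::cstar_algebra \<Rightarrow> 'a) \<Rightarrow> ('g \<Rightarrow> 'a \<Rightarrow> 'a) \<Rightarrow> bool" where
  "complete_interaction V H \<longleftrightarrow> interaction V H
     \<and> (\<forall>x\<ge>0. \<forall>a. H x (V x a) = H x 1 * a * H x 1 \<and> V x (H x a) = V x 1 * a * V x 1)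
     \<and> (\<forall>x\<ge>0. \<forall>y\<ge>0. H y 1 * V x 1 = V x 1 * H y 1)"

definition cond2 :: "('g::linordered_ab_group_add \<Rightarrow> 'a::cstar_algebra \<Rightarrow> 'a) \<Rightarrow> ('g \<Rightarrow> 'a \<Rightarrow> 'a) \<Rightarrow> bool" where
  "cond2 V H \<longleftrightarrow> interaction V H
     \<and> (\<forall>x\<ge>0. hereditary_subalg (range (V x)) \<and> hereditary_subalg (range (H x)))
     \<and> (\<forall>x\<ge>0. \<forall>y\<ge>0. V x 1 * H y 1 = H y 1 * V x 1)"

definition cond3i :: "('g::linordered_ab_group_add \<Rightarrow> 'a::cstar_algebra \<Rightarrow> 'a) \<Rightarrow> bool" where
  "cond3i V \<longleftrightarrow> (\<forall>x\<ge>0. is_proj (V x 1) \<and> range (V x) = corner (V x 1))"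

definition cond3ii :: "('g::linordered_ab_group_add \<Rightarrow> 'a::cstar_algebra \<Rightarrow> 'a) \<Rightarrow> ('g \<Rightarrow> 'a) \<Rightarrow> bool" where
  "cond3ii V P \<longleftrightarrow>
     (\<forall>x\<ge>0. is_proj (P x))
     \<and> (\<forall>x y. 0 \<le> x \<longrightarrow> x \<le> y \<longrightarrow> cle (P y) (P x))
     \<and> (\<forall>x\<ge>0. \<forall>y\<ge>0. V x 1 * P y = P y * V x 1)
     \<and> (\<forall>x\<ge>0. \<forall>y\<ge>0. V x (P (x + y)) = V x 1 * P y)
     \<and> (\<forall>x\<ge>0. star_iso_on (V x) (corner (P x)) (range (V x)))"

end

theory Submission
  imports Defs
begin

text \<open>
  In an interaction, \<open>V x 1 = V x (H x 1)\<close> is a projection and the unit of the range of \<open>V x\<close>; the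
  range is hereditary iff it is the whole corner of \<open>V x 1\<close>, which is what completeness says. Hence
  conditions 1) and 2) agree for each fixed \<open>H\<close>, and \<open>P x = H x 1\<close> satisfies 3). Conversely,
  \<open>V x (P x) = V x 1\<close> and the Cauchy--Schwarz inequality force \<open>V x a = V x (P x * a * P x)\<close>, so the
  formula for \<open>H x\<close> inverts \<open>V x\<close> on corners and inherits positivity and contractivity from the
  *-isomorphism.

  The C*-algebraic input is that the elements \<open>b\<^sup>* b\<close> form a proper cone admitting square roots in
  the bicommutant. This is derived without spectral theory: \<open>sa_pos\<close> characterises positivity by
  \<open>norm (t - a) \<le> t\<close>, and Kaplansky's argument shows that every \<open>b\<^sup>* b\<close> satisfies it.
\<close>

section \<open>Positivity in C*-algebras\<close>

lemma adj_0 [simp]: "adj (0::'a::cstar_algebra) = 0"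
  using adj_add[of "0::'a" 0] by simp

lemma adj_minus [simp]: "adj (- x) = - adj (x::'a::cstar_algebra)"
  using adj_add[of x "- x"] by (simp add: eq_neg_iff_add_eq_0 add.commute)

lemma adj_diff: "adj (x - y) = adj x - adj (y::'a::cstar_algebra)"
  using adj_add[of x "- y"] by simp

lemma adj_one [simp]: "adj 1 = (1::'a::cstar_algebra)"
  using adj_mult[of "adj 1" "1::'a"] by (simp add: adj_adj)

lemma adj_scaleR: "adj (r *\<^sub>R x) = r *\<^sub>R adj (x::'a::cstar_algebra)"
  using adj_cscale[of "complex_of_real r" x] by (simp add: cscale_of_real)

lemma norm_adj [simp]: "norm (adj x) = norm (x::'a::cstar_algebra)"
proof -
  have le: "norm y \<le> norm (adj y)" for y :: 'a
  proof (cases "y = 0")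
    case False
    have "norm y * norm y \<le> norm (adj y) * norm y"
      using norm_mult_ineq[of "adj y" y] by (simp add: cstar_identity power2_eq_square)
    then show ?thesis using False by simp
  qed simp
  show ?thesis using le[of x] le[of "adj x"] by (simp add: adj_adj)
qed

lemma bounded_linear_adj: "bounded_linear (adj :: 'a::cstar_algebra \<Rightarrow> 'a)"
  by (rule bounded_linear_intro[where K = 1]) (auto simp: adj_add adj_scaleR)

lemma norm_sa_square: "adj x = x \<Longrightarrow> norm (x * x) = (norm (x::'a::cstar_algebra))\<^sup>2"
  using cstar_identity[of x] by simp

lemma adj_mult_self_eq_0: "adj x * x = 0 \<Longrightarrow> x = (0::'a::cstar_algebra)"
  using cstar_identity[of x] by simp

text \<open>Multiplication by the scalar i becomes multiplication by a central ring element, so that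
  ring normalisation can handle real and imaginary parts.\<close>

definition imag_unit :: "'a::cstar_algebra" where
  "imag_unit = cscale \<i> 1"

lemma imag_unit_mult: "imag_unit * x = cscale \<i> (x::'a::cstar_algebra)"
  by (simp add: imag_unit_def cscale_mult_left[symmetric])

lemma imag_unit_central: "x * imag_unit = imag_unit * (x::'a::cstar_algebra)"
  by (simp add: imag_unit_mult) (simp add: imag_unit_def cscale_mult_right[symmetric])

lemma imag_unit_square: "imag_unit * (imag_unit * x) = - (x::'a::cstar_algebra)"
  using cscale_of_real[of "-1" x] by (simp add: imag_unit_mult cscale_cscale)

lemma imag_unit_square_mid: "imag_unit * (x * (imag_unit * y)) = - ((x::'a::cstar_algebra) * y)"
proof -
  have "imag_unit * (x * (imag_unit * y)) = imag_unit * (imag_unit * (x * y))"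
    by (metis imag_unit_central mult.assoc)
  then show ?thesis by (simp add: imag_unit_square)
qed

lemma cscale_minus_left: "cscale (- c) x = - cscale c (x::'a::cstar_algebra)"
proof -
  have "cscale 0 x = 0" using cscale_of_real[of 0 x] by simp
  then show ?thesis
    using cscale_add_left[of c "- c" x] by (simp add: eq_neg_iff_add_eq_0 add.commute)
qed

lemma adj_imag_unit: "adj imag_unit = - (imag_unit::'a::cstar_algebra)"
  by (simp add: imag_unit_def adj_cscale cscale_minus_left)

lemma norm_imag_unit_mult [simp]: "norm (imag_unit * x) = norm (x::'a::cstar_algebra)"
  by (simp add: imag_unit_mult norm_cscale)

lemma adj_imag_unit_mult: "adj (imag_unit * x) = - (imag_unit * adj (x::'a::cstar_algebra))"
  by (simp add: adj_mult adj_imag_unit imag_unit_central)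

text \<open>Commutation cancels the mixed terms of \<open>adj z * z\<close> for
  \<open>z = a + imag_unit * b\<close>, and the C*-identity then applies.\<close>

lemma norm_square_sum:
  fixes a b :: "'a::cstar_algebra"
  assumes "adj a = a" "adj b = b" "a * b = b * a"
  shows "norm (a * a + b * b) = (norm (a + imag_unit * b))\<^sup>2"
proof -
  have "adj (a + imag_unit * b) * (a + imag_unit * b)
      = a * a + a * (imag_unit * b) - imag_unit * (b * a) - imag_unit * (b * (imag_unit * b))"
    by (simp add: adj_add adj_imag_unit_mult assms(1,2) algebra_simps)
  also have "a * (imag_unit * b) = imag_unit * (b * a)"
    using assms(3) by (metis imag_unit_central mult.assoc)
  finally show ?thesis
    by (simp add: imag_unit_square_mid cstar_identity[symmetric])
qed

lemma norm_le_norm_add_imag: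
  fixes a b :: "'a::cstar_algebra"
  assumes "adj a = a" "adj b = b"
  shows "norm a \<le> norm (a + imag_unit * b)" "norm b \<le> norm (a + imag_unit * b)"
proof -
  let ?w = "a + imag_unit * b"
  have aw: "adj ?w = a - imag_unit * b"
    by (simp add: adj_add adj_imag_unit_mult assms)
  have "norm (?w + adj ?w) \<le> 2 * norm ?w"
    using norm_triangle_ineq[of ?w "adj ?w"] by simp
  moreover have "?w + adj ?w = 2 *\<^sub>R a" by (simp add: aw scaleR_2)
  ultimately show "norm a \<le> norm ?w" by simp
  have "norm (?w - adj ?w) \<le> 2 * norm ?w"
    using norm_triangle_ineq4[of ?w "adj ?w"] by simp
  moreover have "?w - adj ?w = imag_unit * (2 *\<^sub>R b)" by (simp add: aw scaleR_2 algebra_simps)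
  ultimately show "norm b \<le> norm ?w" by (metis norm_imag_unit_mult norm_scaleR abs_numeral mult_le_cancel_left_pos zero_less_numeral)
qed

text \<open>The iteration \<open>y \<mapsto> (x + y\<^sup>2) / 2\<close> converges to \<open>1 - sqrt (1 - x)\<close> even on the boundary
  \<open>norm x = 1\<close>: it is dominated by the same iteration for the real number \<open>1\<close>.\<close>

primrec sqrt_iter :: "'a::real_normed_algebra_1 \<Rightarrow> nat \<Rightarrow> 'a" where
  "sqrt_iter x 0 = 0"
| "sqrt_iter x (Suc n) = (1/2) *\<^sub>R (x + sqrt_iter x n * sqrt_iter x n)"

lemma sqrt_iter_one_bounds:
  "0 \<le> sqrt_iter (1::real) n \<and> sqrt_iter (1::real) n \<le> 1"
proof (induction n)
  case (Suc n)
  then have "sqrt_iter 1 n * sqrt_iter 1 n \<le> (1::real)" by (simp add: mult_le_one)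
  then show ?case using Suc by simp
qed simp

lemma sqrt_iter_commute:
  "z * x = x * z \<Longrightarrow> z * sqrt_iter x n = sqrt_iter x n * z"
  by (induction n) (simp_all add: algebra_simps, metis mult.assoc)

lemma norm_sqrt_iter_le:
  "norm x \<le> 1 \<Longrightarrow> norm (sqrt_iter x n) \<le> sqrt_iter (1::real) n"
proof (induction n)
  case (Suc n)
  have "norm (sqrt_iter x n * sqrt_iter x n) \<le> sqrt_iter 1 n * sqrt_iter (1::real) n"
    by (rule order_trans[OF norm_mult_ineq])
       (use Suc sqrt_iter_one_bounds in \<open>auto intro!: mult_mono\<close>)
  then show ?case
    using Suc.prems norm_triangle_ineq[of x "sqrt_iter x n * sqrt_iter x n"] by simp
qed simp

text \<open>Each iterate commutes with \<open>x\<close> and hence with the next iterate, so a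
  difference of squares factors as a difference times a sum; the scalar recursion obeys the same
  identity.\<close>

lemma norm_sqrt_iter_diff_le:
  assumes "norm x \<le> 1"
  shows "norm (sqrt_iter x (Suc n) - sqrt_iter x n) \<le> sqrt_iter (1::real) (Suc n) - sqrt_iter 1 n"
proof (induction n)
  case 0
  then show ?case using assms by simp
next
  case (Suc n)
  let ?y = "sqrt_iter x n" and ?y' = "sqrt_iter x (Suc n)"
  let ?r = "sqrt_iter (1::real) n" and ?r' = "sqrt_iter (1::real) (Suc n)"
  have "?y * x = x * ?y" using sqrt_iter_commute[of x x n] by simp
  then have comm: "?y * ?y' = ?y' * ?y" by (rule sqrt_iter_commute)
  have "sqrt_iter x (Suc (Suc n)) - ?y' = (1/2) *\<^sub>R (?y' * ?y' - ?y * ?y)"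
    unfolding sqrt_iter.simps(2)[of x "Suc n"] by (subst (3) sqrt_iter.simps(2)) (simp only: algebra_simps)
  also have "?y' * ?y' - ?y * ?y = (?y' - ?y) * (?y' + ?y)"
    using comm by (simp only: algebra_simps)
  finally have "norm (sqrt_iter x (Suc (Suc n)) - ?y') = (1/2) * norm ((?y' - ?y) * (?y' + ?y))"
    by simp
  also have "\<dots> \<le> (1/2) * ((?r' - ?r) * (?r' + ?r))"
  proof -
    have "norm (?y' + ?y) \<le> ?r' + ?r"
      by (rule norm_triangle_mono) (rule norm_sqrt_iter_le[OF assms])+
    then have "norm (?y' - ?y) * norm (?y' + ?y) \<le> (?r' - ?r) * (?r' + ?r)"
      by (intro mult_mono Suc.IH) (use Suc.IH norm_ge_zero order_trans in blast)+
    then show ?thesis using norm_mult_ineq[of "?y' - ?y" "?y' + ?y"] by linarith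
  qed
  also have "\<dots> = sqrt_iter 1 (Suc (Suc n)) - ?r'"
  proof -
    have "2 * ?r' = 1 + ?r * ?r" by simp
    moreover have "2 * sqrt_iter 1 (Suc (Suc n)) = 1 + ?r' * ?r'"
      unfolding sqrt_iter.simps(2)[of _ "Suc n"] by (simp del: sqrt_iter.simps)
    moreover have "(?r' - ?r) * (?r' + ?r) = ?r' * ?r' - ?r * ?r" by (simp only: algebra_simps)
    ultimately show ?thesis by linarith
  qed
  finally show ?case .
qed

lemma sqrt_iter_convergent:
  fixes x :: "'a::{real_normed_algebra_1, banach}"
  assumes "norm x \<le> 1"
  shows "convergent (sqrt_iter x)"
proof -
  let ?d = "\<lambda>n. sqrt_iter (1::real) (Suc n) - sqrt_iter 1 n"
  have nonneg: "0 \<le> ?d n" for n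
    using order_trans[OF norm_ge_zero norm_sqrt_iter_diff_le[OF assms]] .
  have "incseq (sqrt_iter (1::real))"
    using nonneg by (intro incseq_SucI) (metis diff_ge_0_iff_ge)
  then obtain L where "sqrt_iter (1::real) \<longlonglongrightarrow> L"
    using incseq_convergent[of "sqrt_iter 1" 1] sqrt_iter_one_bounds by blast
  then have "summable ?d" using telescope_summable by blast
  then have "summable (\<lambda>n. sqrt_iter x (Suc n) - sqrt_iter x n)"
    by (rule summable_comparison_test[rotated]) (use norm_sqrt_iter_diff_le[OF assms] in blast)
  then have "convergent (\<lambda>n. \<Sum>i<n. sqrt_iter x (Suc i) - sqrt_iter x i)"
    by (simp only: summable_iff_convergent)
  then show ?thesis by (simp only: sum_lessThan_telescope sqrt_iter.simps(1) diff_0_right)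
qed

text \<open>The last clause puts the root in the bicommutant; it survives the limit because every
  iterate satisfies it. The norm bound makes \<open>1 - y\<close> positive later.\<close>

lemma sqrt_near_one:
  fixes x :: "'a::cstar_algebra"
  assumes "adj x = x" "norm x \<le> 1"
  obtains y where "adj y = y" "norm y \<le> 1" "(1 - y) * (1 - y) = 1 - x"
    "\<And>z. z * x = x * z \<Longrightarrow> z * y = y * z"
proof -
  obtain y where y: "sqrt_iter x \<longlonglongrightarrow> y"
    using sqrt_iter_convergent[OF assms(2)] by (auto simp: convergent_def)
  have 1: "norm y \<le> 1"
  proof (rule LIMSEQ_le_const2[OF tendsto_norm[OF y]], intro exI allI impI)
    show "norm (sqrt_iter x n) \<le> 1" for n
      using norm_sqrt_iter_le[OF assms(2)] sqrt_iter_one_bounds order_trans by blast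
  qed
  have sa: "adj (sqrt_iter x n) = sqrt_iter x n" for n
    by (induction n) (simp_all add: adj_add adj_mult adj_scaleR assms del: scaleR_add_right)
  have "(\<lambda>n. adj (sqrt_iter x n)) \<longlonglongrightarrow> adj y"
    by (rule bounded_linear.tendsto[OF bounded_linear_adj y])
  then have 2: "adj y = y" using LIMSEQ_unique y by (simp add: sa)
  have "(\<lambda>n. sqrt_iter x (Suc n)) \<longlonglongrightarrow> (1/2) *\<^sub>R (x + y * y)"
    unfolding sqrt_iter.simps by (intro tendsto_intros y)
  then have "y = (1/2) *\<^sub>R (x + y * y)"
    using LIMSEQ_unique LIMSEQ_Suc[OF y] by blast
  then have "2 *\<^sub>R y = x + y * y" by (metis scaleR_half_double scaleR_2 scaleR_add_right)
  then have 3: "(1 - y) * (1 - y) = 1 - x" by (simp add: algebra_simps scaleR_2)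
  have 4: "z * y = y * z" if "z * x = x * z" for z
  proof (rule LIMSEQ_unique)
    show "(\<lambda>n. z * sqrt_iter x n) \<longlonglongrightarrow> z * y" by (intro tendsto_intros y)
    show "(\<lambda>n. z * sqrt_iter x n) \<longlonglongrightarrow> y * z"
      unfolding sqrt_iter_commute[OF that] by (intro tendsto_intros y)
  qed
  show thesis by (rule that[OF 2 1 3 4])
qed

text \<open>The element \<open>h\<close> is the real part of the unitary \<open>h + i sqrt (1 - h\<^sup>2)\<close>.\<close>

lemma norm_one_minus_square_le:
  fixes h :: "'a::cstar_algebra"
  assumes h: "adj h = h" "norm h \<le> 1"
  shows "norm (1 - h * h) \<le> 1"
proof -
  have "norm (h * h) \<le> 1" using h by (simp add: norm_sa_square power_le_one)
  then obtain y where y: "adj y = y" "(1 - y) * (1 - y) = 1 - h * h"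
    "\<And>z. z * (h * h) = (h * h) * z \<Longrightarrow> z * y = y * z"
    using sqrt_near_one[of "h * h"] h by (auto simp: adj_mult)
  define k where "k = 1 - y"
  have k: "adj k = k" "h * k = k * h"
    using y(1) y(3)[of h] by (auto simp: k_def adj_diff algebra_simps)
  have kk: "k * k = 1 - h * h" using y(2) by (simp add: k_def)
  have "(norm (h + imag_unit * k))\<^sup>2 = 1"
    using norm_square_sum[OF h(1) k] by (simp add: kk)
  then have "norm (h + imag_unit * k) = 1"
    by (metis norm_ge_zero power2_eq_1_iff neg_0_le_iff_le not_one_le_zero)
  then have "norm k \<le> 1" using norm_le_norm_add_imag(2)[OF h(1) k(1)] by simp
  then show ?thesis using k(1) by (simp add: kk[symmetric] norm_sa_square power_le_one)
qed

section \<open>The cone of positive self-adjoint elements\<close>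

definition sa_pos :: "'a::cstar_algebra \<Rightarrow> bool" where
  "sa_pos a \<longleftrightarrow> adj a = a \<and> (\<exists>t\<ge>0. norm (t *\<^sub>R 1 - a) \<le> t)"

lemma sa_posD: "sa_pos a \<Longrightarrow> adj a = a"
  by (simp add: sa_pos_def)

text \<open>Closure under sums is just the triangle inequality, which is the advantage of describing
  positivity by a norm.\<close>

lemma sa_pos_add: "sa_pos a \<Longrightarrow> sa_pos b \<Longrightarrow> sa_pos (a + b)"
proof -
  assume "sa_pos a" "sa_pos b"
  then obtain s t where st: "0 \<le> s" "0 \<le> t" "norm (s *\<^sub>R 1 - a) \<le> s" "norm (t *\<^sub>R 1 - b) \<le> t"
    and sa: "adj a = a" "adj b = b"
    by (auto simp: sa_pos_def)
  have "norm ((s *\<^sub>R 1 - a) + (t *\<^sub>R 1 - b)) \<le> s + t"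
    by (rule norm_triangle_mono[OF st(3,4)])
  then have "norm ((s + t) *\<^sub>R 1 - (a + b)) \<le> s + t" by (simp add: algebra_simps)
  with st(1,2) sa show ?thesis unfolding sa_pos_def by (metis adj_add add_nonneg_nonneg)
qed

lemma sa_pos_scaleR: "0 \<le> r \<Longrightarrow> sa_pos a \<Longrightarrow> sa_pos (r *\<^sub>R a)"
proof -
  assume r: "0 \<le> r" and "sa_pos a"
  then obtain t where t: "0 \<le> t" "norm (t *\<^sub>R 1 - a) \<le> t" "adj a = a"
    by (auto simp: sa_pos_def)
  have "norm (r *\<^sub>R (t *\<^sub>R 1 - a)) \<le> r * t" using r t by (simp add: mult_left_mono)
  with r t show ?thesis
    unfolding sa_pos_def by (auto intro!: exI[of _ "r * t"] simp: adj_scaleR algebra_simps)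
qed

lemma sa_pos_norm_minus: "adj a = a \<Longrightarrow> norm a \<le> t \<Longrightarrow> sa_pos (t *\<^sub>R 1 - a)"
  unfolding sa_pos_def using order_trans[OF norm_ge_zero]
  by (intro conjI exI[of _ t]) (auto simp: adj_diff adj_scaleR)

lemma sa_pos_scaleR_one: "0 \<le> t \<Longrightarrow> sa_pos (t *\<^sub>R 1)"
  using sa_pos_norm_minus[of 0 t] by simp

lemma sa_pos_sqrt:
  fixes a :: "'a::cstar_algebra"
  assumes "sa_pos a"
  obtains b where "adj b = b" "sa_pos b" "b * b = a" "\<And>z. z * a = a * z \<Longrightarrow> z * b = b * z"
proof -
  obtain t where t: "0 \<le> t" "norm (t *\<^sub>R 1 - a) \<le> t" and a: "adj a = a"
    using assms by (auto simp: sa_pos_def)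
  show thesis
  proof (cases "t = 0")
    case True
    then have "a = 0" using t by simp
    then show ?thesis using that[of 0] sa_pos_scaleR_one[of 0] by simp
  next
    case False
    then have pos: "t > 0" using t by simp
    define x where "x = 1 - (1/t) *\<^sub>R a"
    have "x = (1/t) *\<^sub>R (t *\<^sub>R 1 - a)" using pos by (simp add: x_def algebra_simps)
    then have "norm x = norm (t *\<^sub>R 1 - a) / t" using pos by simp
    then have nx: "norm x \<le> 1" using t pos by (simp add: divide_le_eq)
    have sx: "adj x = x" by (simp add: x_def adj_diff adj_scaleR a)
    obtain y where y: "adj y = y" "norm y \<le> 1" "(1 - y) * (1 - y) = 1 - x"
      "\<And>z. z * x = x * z \<Longrightarrow> z * y = y * z"
      using sqrt_near_one[OF sx nx] by blast
    define b where "b = sqrt t *\<^sub>R (1 - y)"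
    have "sa_pos (1 - y)" using sa_pos_norm_minus[OF y(1,2)] by simp
    then have 1: "sa_pos b" using t by (simp add: b_def sa_pos_scaleR)
    have 2: "b * b = a" using y(3) pos by (simp add: b_def x_def)
    have 3: "z * b = b * z" if "z * a = a * z" for z
      using y(4)[of z] that by (simp add: b_def x_def algebra_simps)
    show ?thesis using that[OF sa_posD[OF 1] 1 2 3] by blast
  qed
qed

lemma norm_minus_square_le:
  fixes h :: "'a::cstar_algebra"
  assumes h: "adj h = h" and r: "norm h \<le> r"
  shows "norm (r\<^sup>2 *\<^sub>R 1 - h * h) \<le> r\<^sup>2"
proof (cases "r = 0")
  case True
  then show ?thesis using r by simp
next
  case False
  then have pos: "r > 0" using r norm_ge_zero[of h] by linarith
  have "norm (1 - ((1/r) *\<^sub>R h) * ((1/r) *\<^sub>R h)) \<le> 1"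
    by (rule norm_one_minus_square_le) (use h r pos in \<open>auto simp: adj_scaleR field_simps\<close>)
  then have "r\<^sup>2 * norm (1 - ((1/r) *\<^sub>R h) * ((1/r) *\<^sub>R h)) \<le> r\<^sup>2"
    by (simp add: mult_left_le)
  also have "r\<^sup>2 * norm (1 - ((1/r) *\<^sub>R h) * ((1/r) *\<^sub>R h))
      = norm (r\<^sup>2 *\<^sub>R (1 - ((1/r) *\<^sub>R h) * ((1/r) *\<^sub>R h)))" by simp
  also have "r\<^sup>2 *\<^sub>R (1 - ((1/r) *\<^sub>R h) * ((1/r) *\<^sub>R h)) = r\<^sup>2 *\<^sub>R 1 - h * h"
    using pos by (simp add: algebra_simps power2_eq_square)
  finally show ?thesis .
qed

lemma sa_pos_square: "adj h = h \<Longrightarrow> sa_pos (h * h)"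
  unfolding sa_pos_def using norm_minus_square_le[of h "norm h"]
  by (auto simp: adj_mult intro!: exI[of _ "(norm h)\<^sup>2"])

text \<open>The bicommutant clause, used once for each root, makes the roots \<open>c\<close> and
  \<open>d\<close> commute, so \<open>a * b\<close> is the square of the self-adjoint
  \<open>c * d\<close>.\<close>

lemma sa_pos_mult:
  fixes a b :: "'a::cstar_algebra"
  assumes a: "sa_pos a" and b: "sa_pos b" and ab: "a * b = b * a"
  shows "sa_pos (a * b)"
proof -
  obtain c where c: "adj c = c" "c * c = a" "\<And>z. z * a = a * z \<Longrightarrow> z * c = c * z"
    using sa_pos_sqrt[OF a] by blast
  obtain d where d: "adj d = d" "d * d = b" "\<And>z. z * b = b * z \<Longrightarrow> z * d = d * z"
    using sa_pos_sqrt[OF b] by blast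
  have cd: "c * d = d * c" using c(3)[of b] d(3)[of c] ab by simp
  have "(c * d) * (c * d) = a * b" using cd c(2) d(2) by (metis mult.assoc)
  moreover have "adj (c * d) = c * d" using cd c(1) d(1) by (simp add: adj_mult)
  ultimately show ?thesis using sa_pos_square by metis
qed

text \<open>If \<open>1 + i\<^sup>k x\<close> is a contraction for all \<open>k\<close>, then so is \<open>1 + i\<^sup>k (1 + i) x\<close>, since
  \<open>1 + (1 + i) x = ((1 + x)\<^sup>2 + (1 + i x)\<^sup>2) / 2\<close>. Iterating contradicts boundedness unless
  \<open>x = 0\<close>.\<close>

lemma contractions_around_one:
  fixes x :: "'a::cstar_algebra"
  assumes "norm (1 + x) \<le> 1" "norm (1 - x) \<le> 1"
    "norm (1 + imag_unit * x) \<le> 1" "norm (1 - imag_unit * x) \<le> 1"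
  shows "x = 0"
proof -
  define E where "E z \<longleftrightarrow> norm (1 + z) \<le> 1 \<and> norm (1 - z) \<le> 1 \<and>
    norm (1 + imag_unit * z) \<le> 1 \<and> norm (1 - imag_unit * z) \<le> 1" for z :: 'a
  have mean: "norm (1 + (z + imag_unit * z)) \<le> 1"
    if "norm (1 + z) \<le> 1" "norm (1 + imag_unit * z) \<le> 1" for z :: 'a
  proof -
    have "(1 + z) * (1 + z) + (1 + imag_unit * z) * (1 + imag_unit * z)
        = 2 *\<^sub>R (1 + (z + imag_unit * z))"
      by (simp add: algebra_simps scaleR_2 imag_unit_square_mid)
    then have "2 * norm (1 + (z + imag_unit * z))
        = norm ((1 + z) * (1 + z) + (1 + imag_unit * z) * (1 + imag_unit * z))"
      by simp
    also have "\<dots> \<le> 1 + 1"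
    proof (rule norm_triangle_mono)
      show "norm ((1 + z) * (1 + z)) \<le> 1"
        by (rule order_trans[OF norm_mult_ineq]) (simp add: mult_le_one that)
      show "norm ((1 + imag_unit * z) * (1 + imag_unit * z)) \<le> 1"
        by (rule order_trans[OF norm_mult_ineq]) (simp add: mult_le_one that)
    qed
    finally show ?thesis by simp
  qed
  have rot: "E (imag_unit * z)" if "E z" for z
    using that by (simp add: E_def imag_unit_square)
  have step: "E (z + imag_unit * z)" if "E z" for z
  proof -
    have "norm (1 + (y + imag_unit * y)) \<le> 1" if "E y" for y
      using mean that by (simp add: E_def)
    from this[OF that] this[OF rot[OF that]] this[OF rot[OF rot[OF that]]]
      this[OF rot[OF rot[OF rot[OF that]]]]
    show ?thesis by (simp add: E_def imag_unit_square algebra_simps)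
  qed
  have nrm: "norm (z + imag_unit * z) = sqrt 2 * norm z" for z :: 'a
  proof -
    have "cscale 1 z = z" using cscale_of_real[of 1 z] by simp
    then have "z + imag_unit * z = cscale (1 + \<i>) z"
      by (simp add: cscale_add_left imag_unit_mult)
    then show ?thesis by (simp add: norm_cscale cmod_def)
  qed
  have "\<exists>z. E z \<and> norm z = sqrt 2 ^ n * norm x" for n
  proof (induction n)
    case 0
    then show ?case using assms by (auto simp: E_def)
  next
    case (Suc n)
    then obtain z where "E z" "norm z = sqrt 2 ^ n * norm x" by blast
    then show ?case using step[of z] nrm[of z] by (intro exI[of _ "z + imag_unit * z"]) simp
  qed
  moreover have "norm z \<le> 2" if "E z" for z
  proof -
    have "norm ((1 + z) - 1) \<le> 1 + 1"
      by (rule norm_triangle_le_diff) (use that in \<open>simp add: E_def\<close>)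
    then show ?thesis by simp
  qed
  ultimately have le: "sqrt 2 ^ n * norm x \<le> 2" for n by metis
  show ?thesis
  proof (rule ccontr)
    assume "x \<noteq> 0"
    then have "sqrt 2 ^ n \<le> 2 / norm x" for n using le[of n] by (simp add: field_simps)
    moreover obtain n where "2 / norm x < sqrt 2 ^ n" using real_arch_pow[of "sqrt 2"] by auto
    ultimately show False by (metis not_less)
  qed
qed

text \<open>After scaling, \<open>1 + x\<close> and \<open>1 - x\<close> are contractions. The mean
  of their squares is \<open>1 + x * x\<close>, whose norm is the square of that of
  \<open>1 + imag_unit * x\<close>, so \<open>contractions_around_one\<close> applies.\<close>

lemma sa_pos_antisym:
  fixes a :: "'a::cstar_algebra"
  assumes "sa_pos a" "sa_pos (- a)"
  shows "a = 0"
proof -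
  obtain s t where st: "0 \<le> s" "0 \<le> t" "norm (s *\<^sub>R 1 - a) \<le> s" "norm (t *\<^sub>R 1 + a) \<le> t"
    and sa: "adj a = a"
    using assms by (auto simp: sa_pos_def)
  \<comment> \<open>The summand 1 keeps \<open>r\<close> positive when \<open>s\<close> and
    \<open>t\<close> both vanish, so that dividing by \<open>r\<close> is safe.\<close>
  define r where "r = s + t + 1"
  have r: "r > 0" using st by (simp add: r_def)
  have "norm ((t + 1) *\<^sub>R 1 + (s *\<^sub>R 1 - a)) \<le> (t + 1) + s"
    by (rule norm_triangle_mono) (use st in auto)
  then have m: "norm (r *\<^sub>R 1 - a) \<le> r" by (simp add: r_def algebra_simps)
  have "norm ((s + 1) *\<^sub>R 1 + (t *\<^sub>R 1 + a)) \<le> (s + 1) + t"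
    by (rule norm_triangle_mono) (use st in auto)
  then have p: "norm (r *\<^sub>R 1 + a) \<le> r" by (simp add: r_def algebra_simps)
  define x where "x = (1/r) *\<^sub>R a"
  have x: "adj x = x" by (simp add: x_def adj_scaleR sa)
  have "1 - x = (1/r) *\<^sub>R (r *\<^sub>R 1 - a)" "1 + x = (1/r) *\<^sub>R (r *\<^sub>R 1 + a)"
    using r by (simp_all add: x_def algebra_simps)
  then have "norm (1 - x) = norm (r *\<^sub>R 1 - a) / r" "norm (1 + x) = norm (r *\<^sub>R 1 + a) / r"
    using r by simp_all
  then have x1: "norm (1 - x) \<le> 1" "norm (1 + x) \<le> 1" using m p r by (simp_all add: divide_le_eq)
  have "2 *\<^sub>R (1 + x * x) = (1 + x) * (1 + x) + (1 - x) * (1 - x)"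
    by (simp add: algebra_simps scaleR_2)
  then have "2 * norm (1 + x * x) = norm ((1 + x) * (1 + x) + (1 - x) * (1 - x))"
    by (metis norm_scaleR abs_numeral)
  also have "\<dots> \<le> 1 + 1"
  proof (rule norm_triangle_mono)
    show "norm ((1 + x) * (1 + x)) \<le> 1" "norm ((1 - x) * (1 - x)) \<le> 1"
      by (rule order_trans[OF norm_mult_ineq], simp add: mult_le_one x1)+
  qed
  finally have xx: "norm (1 + x * x) \<le> 1" by simp
  have "norm (1 + imag_unit * y) \<le> 1" if "adj y = y" "y * y = x * x" for y
  proof -
    have "(norm (1 + imag_unit * y))\<^sup>2 \<le> 1"
      using norm_square_sum[of 1 y] that xx by simp
    then show ?thesis using power2_le_imp_le[of "norm (1 + imag_unit * y)" 1] by simp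
  qed
  from this[of x] this[of "- x"] have "x = 0"
    using x x1 by (intro contractions_around_one) auto
  then show ?thesis using r by (simp add: x_def)
qed

text \<open>The product \<open>(c - q) * (c + q)\<close> is positive, with a root \<open>r\<close>
  commuting with \<open>q\<close>. Then \<open>q + imag_unit * r\<close> has norm \<open>c\<close>,
  and \<open>q\<close> is its real part.\<close>

lemma norm_le_of_sa_pos:
  fixes q :: "'a::cstar_algebra"
  assumes "sa_pos (c *\<^sub>R 1 - q)" "sa_pos (c *\<^sub>R 1 + q)" "0 \<le> c"
  shows "norm q \<le> c"
proof -
  have q: "adj q = q" using sa_posD[OF assms(2)] by (simp add: adj_add adj_scaleR)
  have "sa_pos ((c *\<^sub>R 1 - q) * (c *\<^sub>R 1 + q))"
    by (rule sa_pos_mult[OF assms(1,2)]) (simp add: algebra_simps)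
  then obtain r where r: "adj r = r" "r * r = (c *\<^sub>R 1 - q) * (c *\<^sub>R 1 + q)"
    "\<And>z. z * ((c *\<^sub>R 1 - q) * (c *\<^sub>R 1 + q)) = (c *\<^sub>R 1 - q) * (c *\<^sub>R 1 + q) * z \<Longrightarrow> z * r = r * z"
    using sa_pos_sqrt by metis
  have qr: "q * r = r * q" by (rule r(3)) (simp add: algebra_simps)
  have "q * q + r * r = c\<^sup>2 *\<^sub>R 1" unfolding r(2) by (simp add: algebra_simps power2_eq_square)
  then have "(norm (q + imag_unit * r))\<^sup>2 = c\<^sup>2"
    using norm_square_sum[OF q r(1) qr] by simp
  then have "norm (q + imag_unit * r) = c" using assms(3) by simp
  then show ?thesis using norm_le_norm_add_imag(1)[OF q r(1)] by simp
qed

lemma norm_le_of_sa_pos_le: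
  fixes q :: "'a::cstar_algebra"
  assumes "sa_pos q" "sa_pos (c *\<^sub>R 1 - q)"
  shows "norm q \<le> c"
proof -
  have c: "0 \<le> c"
  proof (rule ccontr)
    assume "\<not> 0 \<le> c"
    then have c: "sa_pos ((- c) *\<^sub>R (1::'a))" by (intro sa_pos_scaleR_one) simp
    have "sa_pos (c *\<^sub>R (1::'a))" using sa_pos_add[OF assms] by simp
    with c have "c *\<^sub>R (1::'a) = 0" by (intro sa_pos_antisym) auto
    with \<open>\<not> 0 \<le> c\<close> show False by simp
  qed
  then have "sa_pos (c *\<^sub>R 1 + q)" using sa_pos_add sa_pos_scaleR_one assms by blast
  with c assms(2) show ?thesis by (simp add: norm_le_of_sa_pos)
qed

lemma norm_scaleR_one_add_sa_pos:
  fixes q :: "'a::cstar_algebra"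
  assumes "sa_pos q" "0 \<le> t"
  shows "norm (t *\<^sub>R 1 + q) = t + norm q"
proof (rule antisym)
  show "norm (t *\<^sub>R 1 + q) \<le> t + norm q"
    using norm_triangle_ineq[of "t *\<^sub>R 1" q] assms(2) by simp
  have "sa_pos (norm (t *\<^sub>R 1 + q) *\<^sub>R 1 - (t *\<^sub>R 1 + q))"
    by (rule sa_pos_norm_minus) (use sa_posD[OF assms(1)] in \<open>auto simp: adj_add adj_scaleR\<close>)
  then have "sa_pos ((norm (t *\<^sub>R 1 + q) - t) *\<^sub>R 1 - q)" by (simp add: algebra_simps)
  from norm_le_of_sa_pos_le[OF assms(1) this] show "t + norm q \<le> norm (t *\<^sub>R 1 + q)" by simp
qed

section \<open>Positivity of the elements \<open>adj u * u\<close>\<close>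

lemma sa_pos_mult_adj_antisym:
  fixes w :: "'a::cstar_algebra"
  assumes a: "sa_pos (w * adj w)" and q: "sa_pos (- (adj w * w))"
  shows "w = 0"
proof -
  obtain t where t: "0 \<le> t" "norm (t *\<^sub>R 1 - w * adj w) \<le> t" using a by (auto simp: sa_pos_def)
  \<comment> \<open>This replaces a comparison of the spectra of \<open>w * adj w\<close> and
    \<open>adj w * w\<close>. The radius \<open>t\<close> of the first gives
    \<open>t * norm q'\<close> as a bound for the norm of \<open>t q' + q'\<^sup>2\<close>;
    completing the square shows that this norm is \<open>t * norm q' + (norm q')\<^sup>2\<close>, so
    \<open>q'\<close> vanishes.\<close>
  define q' where "q' = - (adj w * w)"
  have s: "norm q' = (norm w)\<^sup>2" by (simp add: q'_def cstar_identity)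
  have q': "sa_pos q'" using q by (simp add: q'_def)
  have "adj w * ((t *\<^sub>R 1 - w * adj w) * w) = - (t *\<^sub>R q' + q' * q')"
    by (simp add: q'_def algebra_simps)
  then have "norm (t *\<^sub>R q' + q' * q') = norm (adj w * ((t *\<^sub>R 1 - w * adj w) * w))"
    by (metis norm_minus_cancel)
  also have "\<dots> \<le> norm w * (t * norm w)"
  proof -
    have "norm ((t *\<^sub>R 1 - w * adj w) * w) \<le> t * norm w"
      using norm_mult_ineq[of "t *\<^sub>R 1 - w * adj w" w] mult_right_mono[OF t(2), of "norm w"] by simp
    then show ?thesis
      using norm_mult_ineq[of "adj w" "(t *\<^sub>R 1 - w * adj w) * w"]
      by (smt (verit) mult_left_mono norm_adj norm_ge_zero)
  qed
  finally have le: "norm (t *\<^sub>R q' + q' * q') \<le> t * norm q'" by (simp add: s power2_eq_square mult.left_commute)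
  have z: "sa_pos (t *\<^sub>R q' + q' * q')"
    by (intro sa_pos_add sa_pos_scaleR t q' sa_pos_square sa_posD)
  let ?c = "(t/2) *\<^sub>R 1 + q'"
  have "(t/2)\<^sup>2 + norm (t *\<^sub>R q' + q' * q') = norm ((t/2)\<^sup>2 *\<^sub>R 1 + (t *\<^sub>R q' + q' * q'))"
    by (simp add: norm_scaleR_one_add_sa_pos[OF z])
  also have "(t/2)\<^sup>2 *\<^sub>R 1 + (t *\<^sub>R q' + q' * q') = ?c * ?c"
    by (simp add: algebra_simps power2_eq_square flip: scaleR_add_left)
  also have "norm \<dots> = (t/2 + norm q')\<^sup>2"
    using t sa_posD[OF q'] by (subst norm_sa_square) (auto simp: adj_add adj_scaleR norm_scaleR_one_add_sa_pos[OF q'])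
  finally have "(norm q')\<^sup>2 \<le> 0" using le by (simp add: power2_sum)
  then show ?thesis using s by simp
qed

lemma mult_adj_add_adj_mult_sum_squares:
  fixes w :: "'a::cstar_algebra"
  shows "\<exists>s t. adj s = s \<and> adj t = t \<and> w * adj w + adj w * w = s * s + t * t"
proof -
  \<comment> \<open>Up to sign, \<open>s\<close> and \<open>t\<close> are \<open>sqrt 2\<close>
    times the real and imaginary parts of \<open>w\<close>.\<close>
  define s t where "s = (1 / sqrt 2) *\<^sub>R (w + adj w)" and "t = (1 / sqrt 2) *\<^sub>R (imag_unit * (w - adj w))"
  have "adj s = s" "adj t = t"
    by (simp_all add: s_def t_def adj_scaleR adj_add adj_diff adj_adj adj_imag_unit_mult algebra_simps)
  moreover have "s * s + t * t = (1/2) *\<^sub>R ((w + adj w) * (w + adj w) - (w - adj w) * (w - adj w))"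
    by (simp add: s_def t_def mult.assoc imag_unit_square_mid scaleR_diff_right)
  moreover have "(w + adj w) * (w + adj w) - (w - adj w) * (w - adj w) = 2 *\<^sub>R (w * adj w + adj w * w)"
    by (simp add: algebra_simps scaleR_2)
  ultimately show ?thesis by (intro exI[of _ s] exI[of _ t]) simp
qed

text \<open>With \<open>h = u\<^sup>* u\<close> and \<open>d = |h| - h\<close> one has \<open>d\<^sup>2 = 2 |h| d\<close> and
  \<open>(u d)\<^sup>* (u d) = - |h| d\<^sup>2\<close>.\<close>

lemma sa_pos_adj_mult_self:
  fixes u :: "'a::cstar_algebra"
  shows "sa_pos (adj u * u)"
proof -
  define h where "h = adj u * u"
  have h: "adj h = h" by (simp add: h_def adj_mult adj_adj)
  obtain m where m: "adj m = m" "sa_pos m" "m * m = h * h"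
    "\<And>z. z * (h * h) = (h * h) * z \<Longrightarrow> z * m = m * z"
    using sa_pos_sqrt[OF sa_pos_square[OF h]] by blast
  have hm: "h * m = m * h" by (rule m(4)) (simp add: mult.assoc)
  define d where "d = m - h"
  have d: "adj d = d" "m * d = d * m" "h * d = d * h"
    using hm by (simp_all add: d_def adj_diff m h algebra_simps)
  have dd: "d * d = 2 *\<^sub>R (m * d)"
    using hm m(3) by (simp add: d_def algebra_simps scaleR_2)
  have hd: "h * d = - (m * d)" using hm m(3) by (simp add: d_def algebra_simps)
  define w where "w = u * d"
  have "adj w * w = d * (h * d)" by (simp add: w_def adj_mult d h_def mult.assoc)
  also have "\<dots> = - (m * (d * d))" using hd d(2) by (metis mult.assoc mult_minus_right)
  finally have ww: "adj w * w = - (m * (d * d))" .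
  have "sa_pos (m * (d * d))"
    by (rule sa_pos_mult[OF m(2) sa_pos_square[OF d(1)]]) (metis d(2) mult.assoc)
  then have q: "sa_pos (- (adj w * w))" by (simp add: ww)
  obtain s t where st: "adj s = s" "adj t = t" "w * adj w + adj w * w = s * s + t * t"
    using mult_adj_add_adj_mult_sum_squares by blast
  \<comment> \<open>Sums of squares are positive, and so is \<open>- (adj w * w)\<close>; moving the
    latter across gives positivity of \<open>w * adj w\<close>.\<close>
  have "w * adj w = s * s + t * t + - (adj w * w)" using st(3) by (simp add: algebra_simps)
  then have "sa_pos (w * adj w)" using st(1,2) q by (metis sa_pos_add sa_pos_square)
  with q have "w = 0" by (rule sa_pos_mult_adj_antisym[rotated])
  then have "m * (d * d) = 0" using ww by simp
  then have "(d * d) * (d * d) = 0" by (metis dd d(2) mult.assoc mult_scaleR_left mult_zero_right scaleR_zero_right)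
  then have "d = 0" using norm_sa_square[of "d * d"] norm_sa_square[of d] d(1) by (simp add: adj_mult)
  then show ?thesis using m(2) by (simp add: d_def h_def)
qed

text \<open>Through this equivalence the cone properties of the norm description pass to elements
  \<open>adj b * b\<close>, for which closure under sums is not evident.\<close>

lemma cpos_iff_sa_pos: "cpos a \<longleftrightarrow> sa_pos a"
  unfolding cpos_def by (metis sa_pos_adj_mult_self sa_pos_sqrt)

lemma cpos_adj_self: "cpos (adj a * a)"
  by (auto simp: cpos_def)

lemma cpos_sa: "cpos a \<Longrightarrow> adj a = a"
  by (simp add: cpos_iff_sa_pos sa_posD)

lemma cpos_antisym: "cpos a \<Longrightarrow> cpos (- a) \<Longrightarrow> a = 0"
  by (simp add: cpos_iff_sa_pos sa_pos_antisym)

lemma cpos_norm_minus: "adj a = a \<Longrightarrow> norm a \<le> t \<Longrightarrow> cpos (t *\<^sub>R 1 - a)"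
  by (simp add: cpos_iff_sa_pos sa_pos_norm_minus)

lemma cpos_conj: "cpos a \<Longrightarrow> cpos (adj b * a * b)"
  unfolding cpos_def by (metis adj_mult mult.assoc)

lemma cpos_proj: "is_proj p \<Longrightarrow> cpos p"
  by (metis cpos_adj_self is_proj_def)

lemma is_proj_one_minus: "is_proj p \<Longrightarrow> is_proj (1 - p)"
  by (simp add: is_proj_def adj_diff algebra_simps)

lemma cartesian_decomposition:
  fixes a :: "'a::cstar_algebra"
  obtains s t where "adj s = s" "adj t = t" "a = s + imag_unit * t"
proof
  let ?s = "(1/2) *\<^sub>R (a + adj a)" and ?t = "(1/2) *\<^sub>R (imag_unit * (adj a - a))"
  show "adj ?s = ?s" "adj ?t = ?t"
    by (simp_all add: adj_scaleR adj_add adj_diff adj_adj adj_imag_unit_mult algebra_simps)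
  show "a = ?s + imag_unit * ?t"
    by (simp add: imag_unit_square flip: scaleR_add_right)
qed

section \<open>Corners and hereditary subalgebras\<close>

lemma corner_iff:
  assumes "is_proj p"
  shows "a \<in> corner p \<longleftrightarrow> p * a = a \<and> a * p = a"
proof -
  have pp: "p * p = p" using assms by (simp add: is_proj_def)
  show ?thesis
  proof
    assume "a \<in> corner p"
    then obtain c where "a = p * c * p" by (auto simp: corner_def)
    then show "p * a = a \<and> a * p = a" using pp by (metis mult.assoc)
  next
    assume "p * a = a \<and> a * p = a"
    then have "a = p * a * p" by simp
    then show "a \<in> corner p" unfolding corner_def by blast
  qed
qed

lemma compress_in_corner: "p * a * p \<in> corner p"
  by (auto simp: corner_def)

text \<open>The factor lying in the corner absorbs \<open>p\<close> on both sides, which allows a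
  \<open>p\<close> to be inserted between \<open>a\<close> and \<open>b\<close>.\<close>

lemma compress_mult:
  assumes "is_proj p" "a \<in> corner p \<or> b \<in> corner p"
  shows "p * (a * b) * p = (p * a * p) * (p * b * p)"
  using assms(2)
proof
  assume "a \<in> corner p"
  then have a: "p * a = a" "a * p = a" using corner_iff[OF assms(1)] by blast+
  have "p * (a * b) * p = (p * a) * (b * p)" by (simp only: mult.assoc)
  also have "\<dots> = (a * p) * (b * p)" by (simp only: a)
  also have "\<dots> = (p * a * p) * (p * b * p)" by (simp only: a mult.assoc[symmetric])
  finally show ?thesis .
next
  assume "b \<in> corner p"
  then have b: "p * b = b" "b * p = b" using corner_iff[OF assms(1)] by blast+
  have "p * (a * b) * p = (p * a) * (b * p)" by (simp only: mult.assoc)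
  also have "\<dots> = (p * a) * (p * b)" by (simp only: b)
  also have "\<dots> = (p * a * p) * (p * b * p)" by (simp only: b mult.assoc)
  finally show ?thesis .
qed

lemma proj_in_corner: "is_proj p \<Longrightarrow> p \<in> corner p"
  by (simp add: corner_iff) (simp add: is_proj_def)

text \<open>If \<open>0 \<le> a \<le> b\<close> and \<open>b\<close> lies in the corner, then compressing to \<open>1 - p\<close> squeezes \<open>a\<close> to \<open>0\<close>.\<close>

lemma corner_of_cle:
  assumes p: "is_proj p" and a: "cpos a" and b: "b \<in> corner p" and le: "cle a b"
  shows "a \<in> corner p"
proof -
  let ?q = "1 - p"
  have q: "adj ?q = ?q" using is_proj_one_minus[OF p] by (simp add: is_proj_def)
  have bq: "b * ?q = 0" using b p by (simp add: corner_iff algebra_simps)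
  have "cpos (adj ?q * (b - a) * ?q)" using le cpos_conj by (simp add: cle_def)
  moreover have "adj ?q * (b - a) * ?q = - (adj ?q * a * ?q)"
    using bq by (simp add: mult.assoc left_diff_distrib[of b a])
  ultimately have "adj ?q * a * ?q = 0"
    using cpos_antisym cpos_conj[OF a] by metis
  moreover obtain d where d: "a = adj d * d" using a by (auto simp: cpos_def)
  ultimately have "adj (d * ?q) * (d * ?q) = 0" by (simp add: adj_mult mult.assoc)
  then have "d * ?q = 0" by (rule adj_mult_self_eq_0)
  then have ap: "a * p = a" using d by (simp add: algebra_simps mult.assoc)
  then have "p * a = a" using cpos_sa[OF a] p by (metis adj_mult is_proj_def)
  with ap p show ?thesis by (simp add: corner_iff)
qed

text \<open>The bicommutant clause makes the root commute with \<open>p\<close>, so cutting it down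
  by \<open>p\<close> leaves a self-adjoint element with the same square.\<close>

lemma corner_cpos_sqrt:
  assumes p: "is_proj p" and a: "a \<in> corner p" "cpos a"
  obtains b where "b \<in> corner p" "adj b = b" "a = b * b"
proof -
  obtain b where b: "adj b = b" "b * b = a" "\<And>z. z * a = a * z \<Longrightarrow> z * b = b * z"
    using sa_pos_sqrt a(2) by (metis cpos_iff_sa_pos)
  have pa: "p * a = a" "a * p = a" using a p by (simp_all add: corner_iff)
  then have pb: "p * b = b * p" using b(3) by simp
  have pp: "p * p = p" "adj p = p" using p by (simp_all add: is_proj_def)
  have "b * p \<in> corner p" using p pb pp by (simp add: corner_iff) (metis mult.assoc)
  moreover have "adj (b * p) = b * p" using b(1) pb pp by (simp add: adj_mult)
  moreover have "a = (b * p) * (b * p)" using pb pp b(2) pa by (metis mult.assoc)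
  ultimately show thesis by (rule that)
qed

lemma corner_hereditary:
  assumes p: "is_proj p"
  shows "hereditary_subalg (corner p)"
  unfolding hereditary_subalg_def
proof (intro conjI ballI allI impI)
  have eq: "corner p = {a. p * a = a} \<inter> {a. a * p = a}" using corner_iff[OF p] by blast
  show "closed (corner p)"
    unfolding eq by (intro closed_Int closed_Collect_eq continuous_intros)
  show "a \<in> corner p" if "b \<in> corner p" "cpos a" "cle a b" for a b
    using corner_of_cle[OF p] that by blast
  show "cscale c a \<in> corner p" if "a \<in> corner p" for c a
    using that by (simp add: corner_iff[OF p]) (metis cscale_mult_left cscale_mult_right)
  show "adj a \<in> corner p" if "a \<in> corner p" for a
    using that p by (simp add: corner_iff[OF p]) (metis adj_mult is_proj_def)
  show "a * b \<in> corner p" if "a \<in> corner p" "b \<in> corner p" for a b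
    using that by (simp add: corner_iff[OF p]) (metis mult.assoc)
qed (auto simp: corner_iff[OF p] distrib_left distrib_right)

lemma hereditary_subalgD:
  assumes "hereditary_subalg B"
  shows "a \<in> B \<Longrightarrow> b \<in> B \<Longrightarrow> a + b \<in> B" "a \<in> B \<Longrightarrow> cscale c a \<in> B"
    "b \<in> B \<Longrightarrow> cpos a \<Longrightarrow> cle a b \<Longrightarrow> a \<in> B"
  using assms by (simp_all add: hereditary_subalg_def)

lemma hereditary_subalg_scaleR: "hereditary_subalg B \<Longrightarrow> a \<in> B \<Longrightarrow> r *\<^sub>R a \<in> B"
  using hereditary_subalgD(2)[of B a "complex_of_real r"] by (simp add: cscale_of_real)

lemma hereditary_subalg_diff: "hereditary_subalg B \<Longrightarrow> a \<in> B \<Longrightarrow> b \<in> B \<Longrightarrow> a - b \<in> B"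
proof -
  assume B: "hereditary_subalg B" "a \<in> B" "b \<in> B"
  then have "- b \<in> B" using hereditary_subalg_scaleR[of B b "-1"] by simp
  then have "a + - b \<in> B" by (rule hereditary_subalgD(1)[OF B(1,2)])
  then show ?thesis by simp
qed

text \<open>For positive \<open>a\<close>, the element \<open>p * a * p\<close> lies between 0 and
  \<open>norm a\<close> times \<open>p\<close>, so heredity applies. Shifting by a multiple of 1
  covers self-adjoint elements, and the Cartesian decomposition the rest.\<close>

lemma corner_subset_hereditary:
  assumes p: "is_proj p" "p \<in> B" and B: "hereditary_subalg B"
  shows "corner p \<subseteq> B"
proof -
  have pp: "p * p = p" "adj p = p" using p by (simp_all add: is_proj_def)
  have pos: "p * a * p \<in> B" if "cpos a" for a
  proof -
    have "cpos (adj p * (norm a *\<^sub>R 1 - a) * p)"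
      using that by (intro cpos_conj cpos_norm_minus cpos_sa) auto
    then have "cle (p * a * p) (norm a *\<^sub>R p)"
      by (simp add: cle_def pp algebra_simps)
    moreover have "cpos (p * a * p)" using cpos_conj[OF that, of p] pp by simp
    moreover have "norm a *\<^sub>R p \<in> B" using hereditary_subalg_scaleR[OF B p(2)] .
    ultimately show ?thesis using hereditary_subalgD(3)[OF B] by metis
  qed
  have sa: "p * a * p \<in> B" if "adj a = a" for a
  proof -
    have "cpos (norm a *\<^sub>R 1 - (- a))" using that by (intro cpos_norm_minus) auto
    then have "p * (norm a *\<^sub>R 1 - (- a)) * p - norm a *\<^sub>R p \<in> B"
      by (intro hereditary_subalg_diff[OF B] pos hereditary_subalg_scaleR[OF B] p(2))
    then show ?thesis by (simp add: pp algebra_simps)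
  qed
  have "p * a * p \<in> B" for a
  proof -
    obtain s t where st: "adj s = s" "adj t = t" "a = s + imag_unit * t"
      by (rule cartesian_decomposition)
    have "p * a * p = p * s * p + cscale \<i> (p * t * p)"
      by (simp add: st(3) imag_unit_mult[symmetric] distrib_left distrib_right)
         (metis imag_unit_central mult.assoc)
    then show ?thesis
      by (simp add: hereditary_subalgD(1,2)[OF B] sa[OF st(1)] sa[OF st(2)])
  qed
  then show ?thesis by (auto simp: corner_def)
qed

section \<open>Positive maps\<close>

context
  fixes f :: "'a::cstar_algebra \<Rightarrow> 'a"
  assumes f: "clinear_map f"
begin

lemma clinear_map_add: "f (a + b) = f a + f b"
  using f by (simp add: clinear_map_def)

lemma clinear_map_scaleR: "f (r *\<^sub>R a) = r *\<^sub>R f a"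
  using f by (metis clinear_map_def cscale_of_real)

lemma clinear_map_minus: "f (- a) = - f a"
  using clinear_map_scaleR[of "-1" a] by simp

lemma clinear_map_diff: "f (a - b) = f a - f b"
  using clinear_map_add[of a "- b"] by (simp add: clinear_map_minus)

lemma clinear_map_imag_unit: "f (imag_unit * a) = imag_unit * f a"
  using f by (simp add: clinear_map_def imag_unit_mult)

lemma positive_map_adj:
  assumes "positive_map f"
  shows "f (adj a) = adj (f a)"
proof -
  have sa: "adj (f s) = f s" if "adj s = s" for s
  proof -
    have "s = (norm s *\<^sub>R 1 - (- s)) - (norm s *\<^sub>R 1 - 0)" by simp
    moreover have "cpos (f (norm s *\<^sub>R 1 - (- s)))" "cpos (f (norm s *\<^sub>R 1 - 0))"
      using assms that cpos_norm_minus[of "- s" "norm s"] cpos_norm_minus[of 0 "norm s"]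
      unfolding positive_map_def by auto
    ultimately show ?thesis by (metis clinear_map_diff adj_diff cpos_sa)
  qed
  obtain s t where st: "adj s = s" "adj t = t" "a = s + imag_unit * t"
    by (rule cartesian_decomposition)
  then show ?thesis
    using sa by (simp add: adj_add adj_imag_unit_mult clinear_map_add clinear_map_diff clinear_map_minus
        clinear_map_imag_unit)
qed

text \<open>Cauchy--Schwarz: \<open>0 \<le> f ((x + s y)\<^sup>* (x + s y)) = s f (x\<^sup>* y + y\<^sup>* x) + s\<^sup>2 f (y\<^sup>* y)\<close> for
  all real \<open>s\<close>; let \<open>s\<close> tend to \<open>0\<close> from both sides.\<close>

lemma positive_map_null:
  assumes pos: "positive_map f" and x: "f (adj x * x) = 0"
  shows "f (adj x * y) = 0"
proof -
  have re: "f (adj x * y) + adj (f (adj x * y)) = 0" for y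
  proof -
    define z w where "z = f (adj x * y) + adj (f (adj x * y))" and "w = f (adj y * y)"
    have yx: "f (adj y * x) = adj (f (adj x * y))"
      using positive_map_adj[OF pos, of "adj x * y"] by (simp add: adj_mult adj_adj)
    have cp: "cpos (s *\<^sub>R z + s\<^sup>2 *\<^sub>R w)" for s
    proof -
      have "cpos (f (adj (x + s *\<^sub>R y) * (x + s *\<^sub>R y)))"
        using pos cpos_adj_self by (auto simp: positive_map_def)
      also have "adj (x + s *\<^sub>R y) * (x + s *\<^sub>R y)
          = adj x * x + s *\<^sub>R (adj x * y + adj y * x) + s\<^sup>2 *\<^sub>R (adj y * y)"
        by (simp add: adj_add adj_scaleR algebra_simps power2_eq_square)
      finally show ?thesis
        by (simp add: clinear_map_add clinear_map_scaleR x z_def w_def yx)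
    qed
    have w: "adj w = w" using pos cpos_adj_self cpos_sa unfolding w_def positive_map_def by blast
    \<comment> \<open>Replacing \<open>w\<close> by the larger scalar \<open>norm w\<close> makes
      \<open>s\<^sup>2 * norm w\<close> plus or minus \<open>s z\<close> positive, which bounds the
      norm of \<open>s z\<close>.\<close>
    have bound: "norm z \<le> s * norm w" if "s > 0" for s
    proof -
      have "sa_pos (s\<^sup>2 *\<^sub>R (norm w *\<^sub>R 1 - w))"
        by (intro sa_pos_scaleR sa_pos_norm_minus w) auto
      then have *: "sa_pos (s' *\<^sub>R z + s'\<^sup>2 *\<^sub>R w + s\<^sup>2 *\<^sub>R (norm w *\<^sub>R 1 - w))" for s'
        using cp sa_pos_add cpos_iff_sa_pos by blast
      have "norm (s *\<^sub>R z) \<le> s\<^sup>2 * norm w"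
        using *[of s] *[of "- s"] by (intro norm_le_of_sa_pos) (auto simp: algebra_simps)
      then show ?thesis using that by (simp add: power2_eq_square)
    qed
    have "norm z \<le> 0 + e" if "e > 0" for e
    proof -
      have "norm z \<le> e / (norm w + 1) * norm w" using bound[of "e / (norm w + 1)"] that
        by (simp add: add_nonneg_pos)
      also have "\<dots> \<le> e" using that by (simp add: pos_divide_le_eq add_nonneg_pos)
      finally show ?thesis by simp
    qed
    then have "norm z \<le> 0" using field_le_epsilon by blast
    then show ?thesis by (simp add: z_def)
  qed
  let ?z = "f (adj x * y)"
  \<comment> \<open>Replacing \<open>y\<close> by \<open>imag_unit * y\<close> turns the vanishing
    of the real part into that of the imaginary part.\<close>
  have "adj x * (imag_unit * y) = imag_unit * (adj x * y)" by (metis imag_unit_central mult.assoc)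
  then have "imag_unit * (?z - adj ?z) = 0"
    using re[of "imag_unit * y"] by (simp add: clinear_map_imag_unit adj_imag_unit_mult algebra_simps)
  then have "?z - adj ?z = 0" by (metis norm_imag_unit_mult norm_eq_zero)
  then have "2 *\<^sub>R ?z = 0" using re[of y] by (simp add: scaleR_2)
  then show ?thesis by simp
qed

text \<open>The projection \<open>x = 1 - p\<close> equals \<open>adj x * x\<close> and is sent to
  0, so \<open>positive_map_null\<close> kills \<open>(1 - p) * b\<close>; the right-hand version
  follows by adjoints.\<close>

lemma positive_map_compress:
  assumes pos: "positive_map f" and p: "is_proj p" and eq: "f p = f 1"
  shows "f (p * a) = f a" "f (a * p) = f a" "f (p * a * p) = f a"
proof -
  have q: "adj (1 - p) = 1 - p" "(1 - p) * (1 - p) = 1 - p"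
    using is_proj_one_minus[OF p] by (simp_all add: is_proj_def)
  have null: "f ((1 - p) * b) = 0" for b
    using positive_map_null[OF pos, of "1 - p" b] q by (simp add: clinear_map_diff eq)
  show l: "f (p * b) = f b" for b using null[of b] by (simp add: left_diff_distrib clinear_map_diff)
  show r: "f (b * p) = f b" for b
  proof -
    have "f (p * adj b) = f (adj b)" by (rule l)
    then have "f (adj (b * p)) = f (adj b)" using p by (simp add: adj_mult is_proj_def)
    then show ?thesis by (metis positive_map_adj[OF pos] adj_adj)
  qed
  show "f (p * a * p) = f a" by (simp add: l r)
qed

end

section \<open>Interactions\<close>

text \<open>This is what is used of an interaction at one fixed parameter. By the symmetry in
  \<open>v\<close> and \<open>h\<close>, each fact about \<open>v\<close> is also one about
  \<open>h\<close>.\<close>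

definition interaction_pair :: "('a::cstar_algebra \<Rightarrow> 'a) \<Rightarrow> ('a \<Rightarrow> 'a) \<Rightarrow> bool" where
  "interaction_pair v h \<longleftrightarrow>
     clinear_map v \<and> positive_map v \<and> clinear_map h \<and> positive_map h
     \<and> (\<forall>a. v (h (v a)) = v a) \<and> (\<forall>a. h (v (h a)) = h a)
     \<and> (\<forall>a b. a \<in> range h \<or> b \<in> range h \<longrightarrow> v (a * b) = v a * v b)
     \<and> (\<forall>a b. a \<in> range v \<or> b \<in> range v \<longrightarrow> h (a * b) = h a * h b)"

lemma interaction_pair_sym: "interaction_pair v h \<Longrightarrow> interaction_pair h v"
  unfolding interaction_pair_def by blast

lemma interaction_pairI: "interaction V H \<Longrightarrow> 0 \<le> x \<Longrightarrow> interaction_pair (V x) (H x)"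
  unfolding interaction_def is_action_def interaction_pair_def by (auto simp: fun_eq_iff)

context
  fixes v h :: "'a::cstar_algebra \<Rightarrow> 'a"
  assumes vh: "interaction_pair v h"
begin

lemma pair_mult:
  "v (h a * b) = v (h a) * v b" "v (b * h a) = v b * v (h a)"
  "h (v a * b) = h (v a) * h b" "h (b * v a) = h b * h (v a)"
  using vh unfolding interaction_pair_def by blast+

lemma pair_inv: "v (h (v a)) = v a" "h (v (h a)) = h a"
  using vh unfolding interaction_pair_def by blast+

text \<open>Multiplicativity of both maps gives
  \<open>v b * v (h 1) = v (h (v b * 1)) = v b\<close>, so \<open>v (h 1)\<close> is a unit of the
  range. Taking \<open>b = 1\<close> and splitting \<open>v (1 * h 1)\<close> identifies it with
  \<open>v 1\<close>.\<close>

lemma pair_unit: "v (h 1) = v 1" "v 1 * v a = v a" "v a * v 1 = v a" "is_proj (v 1)"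
proof -
  have r: "v b * v (h 1) = v b" for b
    using pair_mult(1)[of "v b" "h 1"] pair_mult(3)[of b 1] by (simp add: pair_inv)
  have l: "v (h 1) * v b = v b" for b
    using pair_mult(2)[of "h 1" "v b"] pair_mult(4)[of 1 b] by (simp add: pair_inv)
  show e: "v (h 1) = v 1" using pair_mult(2)[of 1 1] r[of 1] by simp
  show "v 1 * v a = v a" "v a * v 1 = v a" using l r by (simp_all add: e)
  have "cpos (v 1)" using vh cpos_adj_self[of "1::'a"] by (simp add: interaction_pair_def positive_map_def)
  then show "is_proj (v 1)" using r[of 1] by (simp add: is_proj_def cpos_sa e)
qed

text \<open>Heredity puts \<open>v 1 * a * v 1\<close> in the range, where \<open>v\<close> after
  \<open>h\<close> is the identity. That composition also splits off both factors
  \<open>v 1\<close>, leaving \<open>v (h a)\<close> between units.\<close>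

lemma pair_compress_of_hereditary:
  assumes "hereditary_subalg (range v)"
  shows "v (h a) = v 1 * a * v 1"
proof -
  have "v 1 * a * v 1 \<in> range v"
    using corner_subset_hereditary[OF pair_unit(4) _ assms] compress_in_corner by blast
  then have "v 1 * a * v 1 = v (h (v 1 * (a * v 1)))" by (auto simp: pair_inv mult.assoc)
  also have "\<dots> = v (h (v 1)) * (v (h a) * v (h (v 1)))" by (simp add: pair_mult)
  finally show ?thesis by (simp add: pair_inv pair_unit)
qed

lemma pair_range_of_compress:
  assumes "\<And>a. v (h a) = v 1 * a * v 1"
  shows "range v = corner (v 1)"
proof
  show "range v \<subseteq> corner (v 1)" using pair_unit by (auto simp: corner_iff)
  show "corner (v 1) \<subseteq> range v" by (auto simp: corner_def assms[symmetric])
qed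

end

section \<open>Completeness and hereditary ranges\<close>

lemma complete_interaction_iff_cond2: "complete_interaction V H \<longleftrightarrow> cond2 V H"
proof
  assume c: "complete_interaction V H"
  show "cond2 V H"
    unfolding cond2_def
  proof (intro conjI allI impI)
    show "interaction V H" using c by (simp add: complete_interaction_def)
    fix x :: 'a assume x: "0 \<le> x"
    have vh: "interaction_pair (V x) (H x)" using \<open>interaction V H\<close> x by (rule interaction_pairI)
    have hv: "interaction_pair (H x) (V x)" using vh by (rule interaction_pair_sym)
    show "hereditary_subalg (range (V x))" "hereditary_subalg (range (H x))"
      using pair_range_of_compress[OF vh] pair_range_of_compress[OF hv] c x
        corner_hereditary[OF pair_unit(4)[OF vh]] corner_hereditary[OF pair_unit(4)[OF hv]]
      by (simp_all add: complete_interaction_def)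
  qed (use c in \<open>simp add: complete_interaction_def\<close>)
next
  assume c: "cond2 V H"
  show "complete_interaction V H"
    unfolding complete_interaction_def
  proof (intro conjI allI impI)
    show "interaction V H" using c by (simp add: cond2_def)
    fix x :: 'a and a assume x: "0 \<le> x"
    have vh: "interaction_pair (V x) (H x)" using \<open>interaction V H\<close> x by (rule interaction_pairI)
    show "V x (H x a) = V x 1 * a * V x 1" "H x (V x a) = H x 1 * a * H x 1"
      using pair_compress_of_hereditary[OF vh] pair_compress_of_hereditary[OF interaction_pair_sym[OF vh]] c x
      by (simp_all add: cond2_def)
  qed (use c in \<open>simp add: cond2_def\<close>)
qed

lemma is_actionD:
  assumes "is_action V" "0 \<le> x"
  shows "clinear_map (V x)" "positive_map (V x)" "0 \<le> y \<Longrightarrow> V x (V y a) = V (x + y) a" "V 0 a = a"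
  using assms by (auto simp: is_action_def fun_eq_iff)

section \<open>From a complete interaction to the projections\<close>

lemma complete_interaction_imp_cond3i:
  assumes "complete_interaction V H"
  shows "cond3i V"
  unfolding cond3i_def
proof (intro allI impI)
  fix x :: 'a assume x: "0 \<le> x"
  have vh: "interaction_pair (V x) (H x)"
    using assms x by (auto simp: complete_interaction_def intro: interaction_pairI)
  show "is_proj (V x 1) \<and> range (V x) = corner (V x 1)"
    using pair_unit(4)[OF vh] pair_range_of_compress[OF vh] assms x by (simp add: complete_interaction_def)
qed

lemma complete_interaction_range:
  assumes c: "complete_interaction V H" and x: "0 \<le> x"
  shows "range (H x) = corner (H x 1)"
proof -
  have "interaction_pair (H x) (V x)"
    using c x by (auto simp: complete_interaction_def intro: interaction_pairI interaction_pair_sym)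
  from pair_range_of_compress[OF this] show ?thesis using c x by (simp add: complete_interaction_def)
qed

lemma complete_interaction_imp_cond3ii:
  assumes c: "complete_interaction V H"
  shows "cond3ii V (\<lambda>x. H x 1)"
  unfolding cond3ii_def
proof (intro conjI allI impI)
  have i: "interaction V H" using c by (simp add: complete_interaction_def)
  then have V: "is_action V" and H: "is_action H" by (simp_all add: interaction_def)
  show proj: "is_proj (H x 1)" if "0 \<le> x" for x
    using pair_unit(4)[OF interaction_pair_sym[OF interaction_pairI[OF i that]]] .
  show comm: "V x 1 * H y 1 = H y 1 * V x 1" if "0 \<le> x" "0 \<le> y" for x y
    using c that by (simp add: complete_interaction_def)
  show "cle (H y 1) (H x 1)" if "0 \<le> x" "x \<le> y" for x y
  proof -
    have d: "0 \<le> y - x" using that by simp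
    \<comment> \<open>By the semigroup law the difference is the image under \<open>H x\<close> of
      the complement of the projection \<open>H (y - x) 1\<close>, so positivity of
      \<open>H x\<close> suffices.\<close>
    have "H y 1 = H x (H (y - x) 1)" using is_actionD(3)[OF H that(1) d] by simp
    then have "H x 1 - H y 1 = H x (1 - H (y - x) 1)"
      by (simp add: clinear_map_diff[OF is_actionD(1)[OF H that(1)]])
    moreover have "cpos (1 - H (y - x) 1)" by (intro cpos_proj is_proj_one_minus proj d)
    ultimately show ?thesis
      using is_actionD(2)[OF H that(1)] by (simp add: cle_def positive_map_def)
  qed
  show "V x (H (x + y) 1) = V x 1 * H y 1" if "0 \<le> x" "0 \<le> y" for x y
  proof -
    \<comment> \<open>Completeness turns \<open>V x (H x (H y 1))\<close> into a compression of
      \<open>H y 1\<close>, and commutation brings the two factors \<open>V x 1\<close>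
      together.\<close>
    have "V x (H (x + y) 1) = V x (H x (H y 1))" using is_actionD(3)[OF H that] by simp
    also have "\<dots> = V x 1 * H y 1 * V x 1" using c that by (simp add: complete_interaction_def)
    also have "\<dots> = V x 1 * V x 1 * H y 1" using comm[OF that] by (metis mult.assoc)
    finally show ?thesis using pair_unit(2)[OF interaction_pairI[OF i that(1)]] by simp
  qed
  show "star_iso_on (V x) (corner (H x 1)) (range (V x))" if x: "0 \<le> x" for x
  proof -
    note vh = interaction_pairI[OF i x]
    note lin = is_actionD(1)[OF V x]
    have "bij_betw (V x) (range (H x)) (range (V x))"
      by (rule bij_betwI[where g = "H x"]) (auto simp: pair_inv[OF vh])
    then show ?thesis
      unfolding star_iso_on_def complete_interaction_range[OF c x, symmetric]
      using lin positive_map_adj[OF lin is_actionD(2)[OF V x]]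
      by (auto simp: pair_mult[OF vh] clinear_map_def)
  qed
qed

section \<open>Uniqueness of the projections\<close>

lemma cond3ii_P0:
  assumes "is_action V" "cond3ii V P"
  shows "P 0 = 1"
proof -
  have "star_iso_on (V 0) (corner (P 0)) (range (V 0))" using assms(2) by (simp add: cond3ii_def)
  \<comment> \<open>\<open>V 0\<close> is the identity, so the corner of \<open>P 0\<close> is the
    whole algebra.\<close>
  then have "1 \<in> corner (P 0)"
    using assms(1) by (auto simp: star_iso_on_def bij_betw_def is_action_def)
  then show ?thesis using assms(2) corner_iff[of "P 0" 1] by (simp add: cond3ii_def)
qed

lemma cond3ii_map_P:
  assumes "is_action V" "cond3ii V P" "0 \<le> x"
  shows "V x (P x) = V x 1"
proof -
  have "V x (P (x + 0)) = V x 1 * P 0" using assms(2,3) unfolding cond3ii_def by blast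
  then show ?thesis using cond3ii_P0[OF assms(1,2)] by simp
qed

text \<open>Since \<open>V x P = V x P' = V x 1\<close>, both \<open>P\<close> and \<open>P P' P\<close> lie in the corner of \<open>P\<close> and have
  the same image.\<close>

lemma cond3ii_compress:
  assumes "is_action V" "cond3ii V P" "cond3ii V P'" "0 \<le> x"
  shows "P x * P' x * P x = P x"
proof -
  have P: "is_proj (P x)" and inj: "inj_on (V x) (corner (P x))"
    using assms by (auto simp: cond3ii_def star_iso_on_def bij_betw_def)
  have "V x (P x * P' x * P x) = V x (P' x)"
    by (rule positive_map_compress(3)[OF is_actionD(1,2)[OF assms(1,4)] P cond3ii_map_P[OF assms(1,2,4)]])
  also have "\<dots> = V x (P x)" using cond3ii_map_P assms by metis
  finally show ?thesis using inj compress_in_corner proj_in_corner[OF P] by (metis inj_onD)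
qed

text \<open>By \<open>cond3ii_compress\<close>, \<open>d = Q - Q' Q\<close> satisfies
  \<open>adj d * d = Q - Q Q' Q = 0\<close>, so \<open>Q = Q' Q\<close>. Exchanging the families and
  taking adjoints gives equality.\<close>

lemma cond3ii_unique:
  assumes "is_action V" "cond3ii V P" "cond3ii V P'" "0 \<le> x"
  shows "P x = P' x"
proof -
  have le: "Q x = Q' x * Q x" if Q: "cond3ii V Q" "cond3ii V Q'" for Q Q'
  proof -
    have q: "adj (Q x) = Q x" "Q x * Q x = Q x" "adj (Q' x) = Q' x" "Q' x * Q' x = Q' x"
      using Q assms(4) by (auto simp: cond3ii_def is_proj_def)
    let ?d = "Q x - Q' x * Q x"
    have "adj ?d * ?d = Q x * Q x - Q x * Q' x * Q x - Q x * Q' x * Q x + Q x * (Q' x * Q' x) * Q x"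
      by (simp only: adj_diff adj_mult q(1,3) algebra_simps)
    then have "adj ?d * ?d = 0" using cond3ii_compress[OF assms(1) Q assms(4)] by (simp add: q)
    then have "?d = 0" by (rule adj_mult_self_eq_0)
    then show ?thesis by simp
  qed
  have "adj (P x) = P x" "adj (P' x) = P' x"
    using assms by (auto simp: cond3ii_def is_proj_def)
  then show ?thesis using le[OF assms(2,3)] le[OF assms(3,2)] by (metis adj_mult)
qed

section \<open>Recovering the second action\<close>

context
  fixes V :: "'g::linordered_ab_group_add \<Rightarrow> 'a::cstar_algebra \<Rightarrow> 'a" and P :: "'g \<Rightarrow> 'a"
  assumes V: "is_action V" and c3i: "cond3i V" and c3ii: "cond3ii V P"
begin

text \<open>The candidate for the second action. The inverse makes sense because the compressed
  element lies in the corner of \<open>V x 1\<close>, which is the range of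
  \<open>V x\<close>.\<close>

definition transfer_op :: "'g \<Rightarrow> 'a \<Rightarrow> 'a" where
  "transfer_op x a = the_inv_into (corner (P x)) (V x) (V x 1 * a * V x 1)"

lemma proj_P: "0 \<le> x \<Longrightarrow> is_proj (P x)" and proj_V: "0 \<le> x \<Longrightarrow> is_proj (V x 1)"
  and range_V: "0 \<le> x \<Longrightarrow> range (V x) = corner (V x 1)"
  and comm_VP: "0 \<le> x \<Longrightarrow> 0 \<le> y \<Longrightarrow> V x 1 * P y = P y * V x 1"
  and V_P_add: "0 \<le> x \<Longrightarrow> 0 \<le> y \<Longrightarrow> V x (P (x + y)) = V x 1 * P y"
  and inj_V: "0 \<le> x \<Longrightarrow> inj_on (V x) (corner (P x))"
  and image_V: "0 \<le> x \<Longrightarrow> V x ` corner (P x) = corner (V x 1)"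
  and V_mult_corner: "0 \<le> x \<Longrightarrow> a \<in> corner (P x) \<Longrightarrow> b \<in> corner (P x) \<Longrightarrow> V x (a * b) = V x a * V x b"
  using c3i c3ii by (simp_all add: cond3i_def cond3ii_def star_iso_on_def bij_betw_def)

lemma P_decreasing: "0 \<le> x \<Longrightarrow> 0 \<le> y \<Longrightarrow> P (x + y) \<in> corner (P x)"
  using c3ii corner_of_cle[OF proj_P cpos_proj[OF proj_P] proj_in_corner[OF proj_P]]
  by (simp add: cond3ii_def)

lemma V_unit: "0 \<le> x \<Longrightarrow> V x 1 * V x a = V x a" "0 \<le> x \<Longrightarrow> V x a * V x 1 = V x a"
  using range_V corner_iff[OF proj_V] by blast+

lemmas V_adj = positive_map_adj[OF is_actionD(1,2)[OF V]]

lemma V_compress: "0 \<le> x \<Longrightarrow> V x (P x * a * P x) = V x a"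
  by (simp add: positive_map_compress is_actionD[OF V] proj_P cond3ii_map_P[OF V c3ii])

lemma corner_P_closed:
  assumes "0 \<le> x" "a \<in> corner (P x)"
  shows "adj a \<in> corner (P x)" "cscale c a \<in> corner (P x)"
    "b \<in> corner (P x) \<Longrightarrow> a + b \<in> corner (P x)" "b \<in> corner (P x) \<Longrightarrow> a * b \<in> corner (P x)"
  using corner_hereditary[OF proj_P[OF assms(1)]] assms(2) by (simp_all add: hereditary_subalg_def)

lemma
  assumes "0 \<le> x"
  shows transfer_in_corner: "transfer_op x a \<in> corner (P x)"
    and V_transfer: "V x (transfer_op x a) = V x 1 * a * V x 1"
  unfolding transfer_op_def
  using the_inv_into_into[OF inj_V _ order_refl] f_the_inv_into_f[OF inj_V] image_V compress_in_corner assms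
  by metis+

text \<open>Membership in the corner and the image under \<open>V x\<close> determine the value;
  algebraic identities for \<open>transfer_op\<close> are checked through these two
  conditions.\<close>

lemma transfer_eqI:
  assumes "0 \<le> x" "b \<in> corner (P x)" "V x b = V x 1 * a * V x 1"
  shows "transfer_op x a = b"
  using the_inv_into_f_f[OF inj_V assms(2)] assms by (simp add: transfer_op_def)

lemma transfer_V: "0 \<le> x \<Longrightarrow> transfer_op x (V x a) = P x * a * P x"
  by (rule transfer_eqI) (auto simp: compress_in_corner V_compress V_unit)

lemma transfer_one: "0 \<le> x \<Longrightarrow> transfer_op x 1 = P x"
  by (rule transfer_eqI)
     (use proj_in_corner proj_P cond3ii_map_P[OF V c3ii] proj_V in \<open>auto simp: is_proj_def\<close>)

lemma clinear_transfer:
  assumes x: "0 \<le> x"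
  shows "clinear_map (transfer_op x)"
  unfolding clinear_map_def
proof (intro conjI allI)
  have lin: "clinear_map (V x)" using is_actionD(1)[OF V x] .
  show "transfer_op x (a + b) = transfer_op x a + transfer_op x b" for a b
    by (rule transfer_eqI[OF x])
       (auto intro!: corner_P_closed transfer_in_corner x
          simp: clinear_map_add[OF lin] V_transfer[OF x] algebra_simps)
  show "transfer_op x (cscale c a) = cscale c (transfer_op x a)" for c a
  proof (rule transfer_eqI[OF x])
    have "V x (cscale c (transfer_op x a)) = cscale c (V x 1 * a * V x 1)"
      using lin by (simp add: clinear_map_def V_transfer[OF x])
    then show "V x (cscale c (transfer_op x a)) = V x 1 * cscale c a * V x 1"
      by (metis cscale_mult_left cscale_mult_right)
  qed (intro corner_P_closed transfer_in_corner x)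
qed

lemma transfer_adj: "0 \<le> x \<Longrightarrow> transfer_op x (adj a) = adj (transfer_op x a)"
  by (rule transfer_eqI)
     (use proj_V in \<open>auto intro!: corner_P_closed transfer_in_corner
        simp: V_adj V_transfer adj_mult is_proj_def mult.assoc\<close>)

lemma transfer_mult:
  assumes x: "0 \<le> x" and "a \<in> corner (V x 1) \<or> b \<in> corner (V x 1)"
  shows "transfer_op x (a * b) = transfer_op x a * transfer_op x b"
proof (rule transfer_eqI[OF x])
  show "transfer_op x a * transfer_op x b \<in> corner (P x)"
    by (intro corner_P_closed transfer_in_corner x)
  have "V x (transfer_op x a * transfer_op x b) = (V x 1 * a * V x 1) * (V x 1 * b * V x 1)"
    by (simp add: V_mult_corner transfer_in_corner x V_transfer)
  also have "\<dots> = V x 1 * (a * b) * V x 1"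
    using compress_mult[OF proj_V[OF x] assms(2)] by simp
  finally show "V x (transfer_op x a * transfer_op x b) = V x 1 * (a * b) * V x 1" .
qed

text \<open>Square roots are taken inside the corner of \<open>V x 1\<close>, where
  \<open>transfer_op x\<close> is multiplicative and so sends \<open>b * b\<close> to a
  square.\<close>

lemma transfer_cpos:
  assumes x: "0 \<le> x" and a: "cpos a"
  shows "cpos (transfer_op x a)"
proof -
  let ?e = "V x 1"
  have e: "?e * ?e = ?e" "adj ?e = ?e" using proj_V[OF x] by (simp_all add: is_proj_def)
  have "cpos (?e * a * ?e)" using cpos_conj[OF a, of ?e] e by simp
  then obtain b where b: "b \<in> corner ?e" "adj b = b" "?e * a * ?e = b * b"
    using corner_cpos_sqrt[OF proj_V[OF x] compress_in_corner] by metis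
  have "?e * a * ?e = ?e * (?e * a * ?e) * ?e" using e by (metis mult.assoc)
  then have "transfer_op x a = transfer_op x (?e * a * ?e)" by (simp add: transfer_op_def)
  also have "\<dots> = adj (transfer_op x b) * transfer_op x b"
    using b transfer_mult[OF x, of b b] transfer_adj[OF x, of b] by simp
  finally show ?thesis by (simp add: cpos_adj_self)
qed

text \<open>Contractivity follows from positivity: \<open>a\<^sup>* a \<le> (norm a)\<^sup>2\<close> is preserved.\<close>

lemma norm_transfer_le:
  assumes x: "0 \<le> x"
  shows "norm (transfer_op x a) \<le> norm a"
proof -
  let ?e = "V x 1"
  have e: "?e * ?e = ?e" "adj ?e = ?e" using proj_V[OF x] by (simp_all add: is_proj_def)
  \<comment> \<open>Compressing \<open>a\<close> keeps its image, does not increase its norm, and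
    makes the multiplicativity of \<open>transfer_op x\<close> available.\<close>
  define b where "b = ?e * a * ?e"
  have b: "b \<in> corner ?e" unfolding b_def by (rule compress_in_corner)
  have "b = ?e * b * ?e" using e by (metis b_def mult.assoc)
  then have tb: "transfer_op x a = transfer_op x b" by (simp add: transfer_op_def b_def)
  have lin: "clinear_map (transfer_op x)" using clinear_transfer[OF x] .
  have "norm ?e \<le> 1"
    using norm_sa_square[OF e(2)] e(1) by (metis norm_ge_zero power2_eq_square mult_cancel_left1 order_refl zero_le_one)
  then have "norm b \<le> 1 * norm a * 1"
    unfolding b_def by (intro order_trans[OF norm_mult_ineq] mult_mono) auto
  then have nb: "norm b \<le> norm a" by simp
  have "cpos ((norm b)\<^sup>2 *\<^sub>R 1 - adj b * b)"
    by (rule cpos_norm_minus) (auto simp: adj_mult adj_adj cstar_identity)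
  from transfer_cpos[OF x this]
  have "cpos ((norm b)\<^sup>2 *\<^sub>R P x - adj (transfer_op x b) * transfer_op x b)"
    using transfer_mult[OF x, of "adj b" b] b
    by (simp add: clinear_map_diff[OF lin] clinear_map_scaleR[OF lin] transfer_one[OF x] transfer_adj[OF x])
  \<comment> \<open>The bound so far is a multiple of \<open>P x\<close>; adding the same multiple
    of \<open>1 - P x\<close> makes it a scalar.\<close>
  moreover have "sa_pos ((norm b)\<^sup>2 *\<^sub>R (1 - P x))"
    using sa_pos_scaleR[of "(norm b)\<^sup>2"] cpos_proj[OF is_proj_one_minus[OF proj_P[OF x]]]
    by (simp add: cpos_iff_sa_pos del: scaleR_diff_right)
  ultimately have "sa_pos (((norm b)\<^sup>2 *\<^sub>R P x - adj (transfer_op x b) * transfer_op x b)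
      + (norm b)\<^sup>2 *\<^sub>R (1 - P x))"
    by (intro sa_pos_add) (simp_all add: cpos_iff_sa_pos)
  then have "sa_pos ((norm b)\<^sup>2 *\<^sub>R 1 - adj (transfer_op x b) * transfer_op x b)"
    by (simp add: algebra_simps)
  then have "norm (adj (transfer_op x b) * transfer_op x b) \<le> (norm b)\<^sup>2"
    by (rule norm_le_of_sa_pos_le[OF sa_pos_adj_mult_self])
  then have "(norm (transfer_op x b))\<^sup>2 \<le> (norm b)\<^sup>2" by (simp only: cstar_identity)
  then have "norm (transfer_op x b) \<le> norm b" by (rule power2_le_imp_le) simp
  then show ?thesis using nb tb by simp
qed

text \<open>By \<open>transfer_eqI\<close> it suffices that the iterated value lies in the smaller
  corner of \<open>P (x + y)\<close> and that \<open>V (x + y)\<close> sends it to the compression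
  of \<open>a\<close>.\<close>

lemma transfer_add:
  assumes x: "0 \<le> x" and y: "0 \<le> y"
  shows "transfer_op x (transfer_op y a) = transfer_op (x + y) a"
proof -
  define c b where "c = transfer_op y a" and "b = transfer_op x c"
  have xy: "0 \<le> x + y" using x y by simp
  have c: "c \<in> corner (P y)" "V y c = V y 1 * a * V y 1"
    using transfer_in_corner[OF y] V_transfer[OF y] by (simp_all add: c_def)
  have b: "b \<in> corner (P x)" "V x b = V x 1 * c * V x 1"
    using transfer_in_corner[OF x] V_transfer[OF x] by (simp_all add: b_def)
  have Pc: "P y * c = c" "c * P y = c" using c(1) corner_iff[OF proj_P[OF y]] by blast+
  note comm = comm_VP[OF x y]
  have e: "V x 1 * V x 1 = V x 1" using proj_V[OF x] by (simp add: is_proj_def)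
  have Py: "P y * P y = P y" using proj_P[OF y] by (simp add: is_proj_def)
  have eP: "V x 1 * P y \<in> corner (P y)"
    using comm Py by (simp add: corner_iff[OF proj_P[OF y]]) (metis mult.assoc)
  have Q: "P (x + y) \<in> corner (P x)" by (rule P_decreasing[OF x y])
  \<comment> \<open>Injectivity of \<open>V x\<close> on the corner of \<open>P x\<close> reduces
    membership of \<open>b\<close> to comparing images: \<open>P (x + y)\<close> becomes
    \<open>V x 1 * P y\<close>, and \<open>c\<close> absorbs the factors \<open>P y\<close>.\<close>
  have "V x (P (x + y) * b * P (x + y)) = (V x 1 * P y) * (V x 1 * c * V x 1) * (V x 1 * P y)"
    using Q b x y by (simp add: V_mult_corner corner_P_closed V_P_add)
  also have "\<dots> = V x 1 * (P y * V x 1) * c * (V x 1 * V x 1) * P y" by (simp only: mult.assoc)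
  also have "\<dots> = V x 1 * (V x 1 * P y) * c * V x 1 * P y" by (simp only: e comm)
  also have "\<dots> = (V x 1 * V x 1) * (P y * c) * (V x 1 * P y)" by (simp only: mult.assoc)
  also have "\<dots> = V x 1 * c * (P y * V x 1)" by (simp only: e Pc comm)
  also have "\<dots> = V x 1 * (c * P y) * V x 1" by (simp only: mult.assoc)
  also have "\<dots> = V x b" by (simp only: Pc b)
  finally have "P (x + y) * b * P (x + y) = b"
    using inj_onD[OF inj_V[OF x]] Q b(1) corner_P_closed(4)[OF x] by blast
  then have bc: "b \<in> corner (P (x + y))" by (metis compress_in_corner)
  \<comment> \<open>The argument is \<open>V x (P (x + y))\<close>, and \<open>V y\<close> after
    \<open>V x\<close> is \<open>V (x + y)\<close>, which sends \<open>P (x + y)\<close> to its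
    value at 1.\<close>
  have VyeP: "V y (V x 1 * P y) = V (x + y) 1"
    using V_P_add[OF x y] is_actionD(3)[OF V y x] cond3ii_map_P[OF V c3ii xy] by (metis add.commute)
  have "V (x + y) 1 = V y (V x 1)" using is_actionD(3)[OF V y x] by (simp add: add.commute)
  then have u: "V (x + y) 1 * V y 1 = V (x + y) 1" "V y 1 * V (x + y) 1 = V (x + y) 1"
    using V_unit[OF y] by simp_all
  have "V (x + y) b = V y (V x 1 * c * V x 1)"
    using is_actionD(3)[OF V y x] b(2) by (metis add.commute)
  \<comment> \<open>Inserting \<open>P y\<close> around \<open>c\<close> places all three factors in
    the corner of \<open>P y\<close>, where \<open>V y\<close> is multiplicative.\<close>
  also have "V x 1 * c * V x 1 = (V x 1 * P y) * c * (V x 1 * P y)"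
  proof -
    have "(V x 1 * P y) * c * (P y * V x 1) = V x 1 * ((P y * c) * P y) * V x 1"
      by (simp only: mult.assoc)
    then show ?thesis by (simp only: Pc comm)
  qed
  also have "V y \<dots> = V (x + y) 1 * V y c * V (x + y) 1"
    using eP c y by (simp add: V_mult_corner corner_P_closed VyeP)
  also have "\<dots> = V (x + y) 1 * a * V (x + y) 1"
  proof -
    have "V (x + y) 1 * (V y 1 * a * V y 1) * V (x + y) 1
        = (V (x + y) 1 * V y 1) * a * (V y 1 * V (x + y) 1)" by (simp only: mult.assoc)
    then show ?thesis by (simp only: c u)
  qed
  finally have "transfer_op (x + y) a = b" using transfer_eqI[OF xy bc] by simp
  then show ?thesis by (simp add: b_def c_def)
qed

lemma transfer_action: "is_action transfer_op"
  unfolding is_action_def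
proof (intro conjI allI impI)
  show "transfer_op 0 = id"
    using transfer_V[of 0] cond3ii_P0[OF V c3ii] is_actionD(4)[OF V, of 0] by (auto simp: fun_eq_iff)
  fix x :: 'g assume x: "0 \<le> x"
  show "bounded_map (transfer_op x)"
    unfolding bounded_map_def using norm_transfer_le[OF x] by (intro exI[of _ 1]) simp
  show "positive_map (transfer_op x)" using transfer_cpos[OF x] by (simp add: positive_map_def)
  show "clinear_map (transfer_op x)" using clinear_transfer[OF x] .
  show "transfer_op x \<circ> transfer_op y = transfer_op (x + y)" if "0 \<le> y" for y
    using transfer_add[OF x that] by (simp add: fun_eq_iff)
qed

lemma transfer_complete_interaction: "complete_interaction V transfer_op"
proof -
  have "interaction V transfer_op"
    unfolding interaction_def
  proof (intro conjI allI impI V transfer_action)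
    fix x :: 'g assume x: "0 \<le> x"
    have rt: "a \<in> corner (P x)" if "a \<in> range (transfer_op x)" for a
      using that transfer_in_corner[OF x] by blast
    show "V x \<circ> transfer_op x \<circ> V x = V x" using x by (simp add: fun_eq_iff V_transfer V_unit)
    show "transfer_op x \<circ> V x \<circ> transfer_op x = transfer_op x"
      using x corner_iff[OF proj_P[OF x]] transfer_in_corner[OF x] by (simp add: fun_eq_iff transfer_V)
    show "transfer_op x (a * b) = transfer_op x a * transfer_op x b"
      if "a \<in> range (V x) \<or> b \<in> range (V x)" for a b
      using transfer_mult[OF x] that range_V[OF x] by simp
    show "V x (a * b) = V x a * V x b" if "a \<in> range (transfer_op x) \<or> b \<in> range (transfer_op x)" for a b
    proof -
      let ?p = "P x"
      \<comment> \<open>\<open>V x\<close> depends only on the compression by \<open>P x\<close>,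
        and it is multiplicative on that corner.\<close>
      have "V x (a * b) = V x (?p * (a * b) * ?p)" using V_compress[OF x] by simp
      also have "?p * (a * b) * ?p = (?p * a * ?p) * (?p * b * ?p)"
        using compress_mult[OF proj_P[OF x]] that rt by blast
      also have "V x \<dots> = V x (?p * a * ?p) * V x (?p * b * ?p)"
        by (intro V_mult_corner x compress_in_corner)
      finally show ?thesis using V_compress[OF x] by simp
    qed
  qed
  then show ?thesis
    unfolding complete_interaction_def using comm_VP by (simp add: transfer_one transfer_V V_transfer)
qed

end

text \<open>Uniqueness identifies \<open>P x\<close> with \<open>H x 1\<close>; then
  \<open>H x a\<close> has the two properties that characterise the transfer operator.\<close>

lemma complete_interaction_eq_transfer:
  assumes c: "complete_interaction V H" and c3: "cond3i V" "cond3ii V P" and x: "0 \<le> x"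
  shows "P x = H x 1 \<and> (\<forall>a. H x a = the_inv_into (corner (P x)) (V x) (V x 1 * a * V x 1))"
proof -
  have V: "is_action V" using c by (simp add: complete_interaction_def interaction_def)
  have P: "P x = H x 1"
    using cond3ii_unique[OF V c3(2) complete_interaction_imp_cond3ii[OF c] x] .
  have "H x a \<in> corner (P x)" for a using complete_interaction_range[OF c x] P by auto
  moreover have "V x (H x a) = V x 1 * a * V x 1" for a using c x by (simp add: complete_interaction_def)
  ultimately show ?thesis
    using transfer_eqI[OF V c3 x] P by (metis transfer_op_def[OF V c3])
qed

theorem theorem3p5:
  fixes V :: "'g::linordered_ab_group_add \<Rightarrow> 'a::cstar_algebra \<Rightarrow> 'a"
  assumes "is_action V"
  shows "((\<exists>H. complete_interaction V H) \<longleftrightarrow> (\<exists>H. cond2 V H))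
       \<and> ((\<exists>H. cond2 V H) \<longleftrightarrow> (cond3i V \<and> (\<exists>P. cond3ii V P)))
       \<and> (\<forall>H H'. (complete_interaction V H \<or> cond2 V H) \<longrightarrow>
                 (complete_interaction V H' \<or> cond2 V H') \<longrightarrow> (\<forall>x\<ge>0. H x = H' x))
       \<and> (\<forall>P P'. cond3i V \<longrightarrow> cond3ii V P \<longrightarrow> cond3ii V P' \<longrightarrow> (\<forall>x\<ge>0. P x = P' x))
       \<and> (\<forall>H P. (complete_interaction V H \<or> cond2 V H) \<longrightarrow> cond3i V \<longrightarrow> cond3ii V P \<longrightarrow>
              (\<forall>x\<ge>0. P x = H x 1
                 \<and> (\<forall>a. H x a = the_inv_into (corner (P x)) (V x) (V x 1 * a * V x 1))))"
proof -
  \<comment> \<open>Both actions are given by one formula in the projections \<open>H x 1\<close> of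
    the first.\<close>
  have H: "H x = H' x"
    if "complete_interaction V H" "complete_interaction V H'" "0 \<le> x" for H H' x
    using complete_interaction_eq_transfer[OF that(1) _ _ that(3)]
      complete_interaction_eq_transfer[OF that(2) _ _ that(3)]
      complete_interaction_imp_cond3i[OF that(1)] complete_interaction_imp_cond3ii[OF that(1)]
    by (metis ext)
  have iff: "(\<exists>H. complete_interaction V H) \<longleftrightarrow> cond3i V \<and> (\<exists>P. cond3ii V P)"
    using complete_interaction_imp_cond3i complete_interaction_imp_cond3ii
      transfer_complete_interaction[OF assms] by metis
  show ?thesis
    unfolding complete_interaction_iff_cond2[symmetric] disj_absorb
    using iff H cond3ii_unique[OF assms] complete_interaction_eq_transfer[of V] by blast
qed

end
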